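(* Let $\{S_e : e\in\mathcal{E}\}$ be a strongly connected graph directed iterated function system (GD-IFS) in $\mathbb{R}^2$ with attractor $(K_1,\ldots,K_q)$, such that at least one $K_i$ contains at least two points, and let $j\in\mathcal{V}=\{1,\dots,q\}$. Then for every $\varepsilon>0$ there exist $r\in(0,1)$, an orthogonal transformation $O\in\mathcal{T}_{j,G}\cap\mathbb{SO}_2$ and a self-similar iterated function system (SS-IFS) $\{S_i\}_{i=1}^m$, $S_i(x)=r_iT_i(x)+v_i$, in $\mathbb{R}^2$ that satisfies the strong separation condition, with attractor $K$, such that $K\subseteq K_j$, $\dim_H K_j-\varepsilon<\dim_H K$, the transformation group $\mathcal{T}$ of $\{S_i\}_{i=1}^m$ is dense in $\mathcal{T}_{j,G}\cap\mathbb{SO}_2$, and $T_i=O$ and $r_i=r$ for every $i\in\{1,\dots,m\}$.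
   Context: Self-similar systems. An SS-IFS in $\mathbb{R}^2$ is a finite collection $\{S_i\}_{i=1}^m$ of contracting similarities of $\mathbb{R}^2$; write $S_i(x)=r_iT_i(x)+v_i$ with $0<r_i<1$, $T_i\in\mathbb{O}_2$ (the orthogonal group), $v_i\in\mathbb{R}^2$. Its attractor is the unique nonempty compact $K$ with $K=\bigcup_{i=1}^m S_i(K)$. The strong separation condition (SSC) means that the sets $S_1(K),\dots,S_m(K)$ are pairwise disjoint. The transformation group $\mathcal{T}$ is the group generated by $T_1,\dots,T_m$. Graph directed systems. Let $G(\mathcal{V},\mathcal{E})$ be a directed graph with vertex set $\mathcal{V}=\{1,\ldots,q\}$ and finite set $\mathcal{E}$ of directed edges (several edges between two vertices and loops are allowed) such that at least one edge starts from each vertex. $\mathcal{E}_{i,j}$ is the set of edges from $i$ to $j$, and $\mathcal{E}_{i,j}^k$ is the set of sequences $(e_1,\ldots,e_k)$ of $k$ edges forming a directed path from $i$ to $j$. A GD-IFS in $\mathbb{R}^2$ is a collection $\{S_e:e\in\mathcal{E}\}$ of contracting similarities of $\mathbb{R}^2$; write $S_e(x)=r_eT_e(x)+v_e$ with $0<r_e<1$, $T_e\in\mathbb{O}_2$, $v_e\in\mathbb{R}^2$. Its attractor is the unique $q$-tuple $(K_1,\ldots,K_q)$ of nonempty compact sets with $K_i=\bigcup_{j=1}^q\bigcup_{e\in\mathcal{E}_{i,j}}S_e(K_j)$ for all $i$. It is strongly connected if for every pair of vertices $i,j$ there is a directed path from $i$ to $j$ and one from $j$ to $i$. $\mathcal{C}_j=\bigcup_{k\ge1}\mathcal{E}_{j,j}^k$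 is the set of directed cycles starting and ending at $j$, and $\mathcal{T}_{j,G}$, the $j$-th transformation group, is the group generated by $\{T_{e_1}\circ\cdots\circ T_{e_k}:(e_1,\ldots,e_k)\in\mathcal{C}_j\}$. $\dim_H$ is Hausdorff dimension; $\mathbb{SO}_2$ is the special orthogonal group. Density is with respect to the usual topology of $\mathbb{O}_2$; "$\mathcal T$ is dense in $\mathcal{T}_{j,G}\cap\mathbb{SO}_2$" means $\mathcal T$ is a dense subset of it. *)

theory Defs
  imports
    "HOL-Analysis.Analysis"
    "HOL-Algebra.Generated_Groups"
    "Graph_Theory.Graph_Theory"
begin

section \<open>Hausdorff measure and dimension\<close>

text \<open>
  The \<open>s\<close>-th power of the diameter, with the usual conventions for \<open>s = 0\<close>: the empty set
  counts 0 and every nonempty set counts 1 (whereas \<open>0 powr 0 = 0\<close> in HOL).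
\<close>

definition diam_power :: "real \<Rightarrow> 'a::metric_space set \<Rightarrow> ennreal" where
  "diam_power s U = (if U = {} then 0 else if s = 0 then 1 else ennreal (diameter U powr s))"

text \<open>
  Boundedness is required separately because \<^const>\<open>diameter\<close> is unspecified on unbounded sets.
  Finite covers are included, as the \<open>U i\<close> may be empty.
\<close>

definition hausdorff_premeasure :: "real \<Rightarrow> real \<Rightarrow> 'a::metric_space set \<Rightarrow> ennreal" where
  "hausdorff_premeasure s \<delta> A =
    (INF U \<in> {U :: nat \<Rightarrow> 'a set. A \<subseteq> (\<Union>i. U i) \<and> (\<forall>i. bounded (U i) \<and> diameter (U i) \<le> \<delta>)}.
      (\<Sum>i. diam_power s (U i)))"

definition hausdorff_measure :: "real \<Rightarrow> 'a::metric_space set \<Rightarrow> ennreal" where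
  "hausdorff_measure s A = (SUP \<delta> \<in> {0<..}. hausdorff_premeasure s \<delta> A)"

definition hausdorff_dim :: "'a::metric_space set \<Rightarrow> ereal" where
  "hausdorff_dim A = (INF s \<in> {s. 0 \<le> s \<and> hausdorff_measure s A = 0}. ereal s)"


section \<open>Contracting similarities of the plane\<close>

text \<open>
  Linear maps of the plane are represented by their matrices, so that the topology of the
  orthogonal group is the one induced by the Euclidean space \<open>real^2^2\<close>.
\<close>

record similarity =
  ratio :: real
  orth :: "real^2^2"
  transl :: "real^2"

definition sim_map :: "similarity \<Rightarrow> real^2 \<Rightarrow> real^2" where
  "sim_map S x = ratio S *\<^sub>R (orth S *v x) + transl S"

definition contracting_similarity :: "similarity \<Rightarrow> bool" where
  "contracting_similarity S \<longleftrightarrow> 0 < ratio S \<and> ratio S < 1 \<and> orthogonal_matrix (orth S)"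

definition O2 :: "(real^2^2) monoid" where
  "O2 = \<lparr>carrier = {A. orthogonal_matrix A}, mult = (**), one = mat 1\<rparr>"

definition SO2 :: "(real^2^2) set" where
  "SO2 = {A. rotation_matrix A}"

lemma group_O2: "group O2"
proof (rule groupI)
  fix A assume "A \<in> carrier O2"
  then show "\<exists>B\<in>carrier O2. B \<otimes>\<^bsub>O2\<^esub> A = \<one>\<^bsub>O2\<^esub>"
    by (intro bexI[of _ "transpose A"]) (auto simp: O2_def orthogonal_matrix_def)
qed (auto simp: O2_def orthogonal_matrix_id orthogonal_matrix_mul matrix_mul_assoc)


section \<open>Self-similar iterated function systems\<close>

definition ss_ifs :: "nat \<Rightarrow> (nat \<Rightarrow> similarity) \<Rightarrow> bool" where
  "ss_ifs m S \<longleftrightarrow> 1 \<le> m \<and> (\<forall>i\<in>{1..m}. contracting_similarity (S i))"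

definition ss_attractor :: "nat \<Rightarrow> (nat \<Rightarrow> similarity) \<Rightarrow> (real^2) set \<Rightarrow> bool" where
  "ss_attractor m S K \<longleftrightarrow> K \<noteq> {} \<and> compact K \<and> K = (\<Union>i\<in>{1..m}. sim_map (S i) ` K)"

text \<open>The strong separation condition, for the attractor \<open>K\<close> of the system.\<close>

definition strong_separation :: "nat \<Rightarrow> (nat \<Rightarrow> similarity) \<Rightarrow> (real^2) set \<Rightarrow> bool" where
  "strong_separation m S K \<longleftrightarrow> disjoint_family_on (\<lambda>i. sim_map (S i) ` K) {1..m}"

definition ss_group :: "nat \<Rightarrow> (nat \<Rightarrow> similarity) \<Rightarrow> (real^2^2) set" where
  "ss_group m S = generate O2 ((\<lambda>i. orth (S i)) ` {1..m})"


section \<open>Graph directed iterated function systems\<close>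

definition gd_ifs :: "(nat, 'e) pre_digraph \<Rightarrow> nat \<Rightarrow> ('e \<Rightarrow> similarity) \<Rightarrow> bool" where
  "gd_ifs G q S \<longleftrightarrow>
    fin_digraph G \<and> verts G = {1..q} \<and>
    (\<forall>i\<in>verts G. \<exists>e\<in>arcs G. tail G e = i) \<and>
    (\<forall>e\<in>arcs G. contracting_similarity (S e))"

definition gd_attractor ::
  "(nat, 'e) pre_digraph \<Rightarrow> ('e \<Rightarrow> similarity) \<Rightarrow> (nat \<Rightarrow> (real^2) set) \<Rightarrow> bool" where
  "gd_attractor G S K \<longleftrightarrow>
    (\<forall>i\<in>verts G. K i \<noteq> {} \<and> compact (K i) \<and>
      K i = (\<Union>j\<in>verts G. \<Union>e\<in>{e\<in>arcs G. tail G e = i \<and> head G e = j}. sim_map (S e) ` K j))"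

definition cycles_at :: "('v, 'e) pre_digraph \<Rightarrow> 'v \<Rightarrow> 'e list set" where
  "cycles_at G j = {p. p \<noteq> [] \<and> pre_digraph.awalk G j p j}"

definition path_orth :: "('e \<Rightarrow> similarity) \<Rightarrow> 'e list \<Rightarrow> real^2^2" where
  "path_orth S p = foldr (\<lambda>e A. orth (S e) ** A) p (mat 1)"

definition gd_group :: "('v, 'e) pre_digraph \<Rightarrow> ('e \<Rightarrow> similarity) \<Rightarrow> 'v \<Rightarrow> (real^2^2) set" where
  "gd_group G S j = generate O2 (path_orth S ` cycles_at G j)"

end

theory Submission
  imports Defs "HOL-Real_Asymp.Real_Asymp"
begin

text \<open>
  Let \<open>0 \<le> t < t' < dim K\<^sub>j\<close> with \<open>t\<close> close to \<open>dim K\<^sub>j\<close>.  It suffices to find cycles \<open>p\<^sub>1, \<dots>, p\<^sub>m\<close> at \<open>j\<close> whose similarities have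
  a common ratio \<open>r\<close> and a common orthogonal part \<open>Q\<close>, map \<open>K\<^sub>j\<close> to disjoint sets, and satisfy
  \<open>m r\<^sup>t \<ge> 1\<close>, where the powers of \<open>Q\<close> are dense in the rotations of the transformation group.  Indeed
  the attractor of these similarities lies in \<open>K\<^sub>j\<close>, is strongly separated because the images of \<open>K\<^sub>j\<close>
  are disjoint, and has dimension at least \<open>t\<close> because \<open>m r\<^sup>t \<ge> 1\<close> (\<open>dim_homogeneous_ge\<close>).

  There are many cycles with disjoint images.  The paths from \<open>j\<close> that are cut off when their ratio is
  comparable to \<open>b\<^sup>n\<close> give pieces of diameter at most \<open>d = D b\<^sup>n\<close> that cover \<open>K\<^sub>j\<close>.  Enlarging the members
  of a maximal disjoint subfamily to diameter \<open>3d\<close> still covers \<open>K\<^sub>j\<close> (\<open>packing_cover\<close>), and since \<open>K\<^sub>j\<close>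
  has positive \<open>t'\<close>-dimensional measure this subfamily has at least \<open>c b\<^bsup>-nt'\<^esup>\<close> members.  Prolonging
  each path back to \<open>j\<close> costs only a bounded factor in the ratio.

  Among them, many have the same linear part, because paths of length at most \<open>n\<close> have only
  polynomially many linear parts (\<open>few_linear_parts\<close>).  A linear similarity of the plane is
  multiplication by a complex number, possibly preceded by conjugation.  The linear part of a path is
  therefore determined by its determinant and by a product of complex numbers, one for each edge, each
  taken from a fixed finite set that is closed under conjugation.  As multiplication of complex numbers
  commutes, only the number of occurrences of each factor matters.  By the pigeonhole principle,
  selecting the cycles with one common linear part loses a polynomial factor only, which for large \<open>n\<close>
  is more than compensated by \<open>t < t'\<close> (\<open>many_equal_cycles\<close>).

  The common orthogonal part \<open>T\<close> obtained in this way is not under control, but there is a finite set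
  of cycles such that, whatever \<open>T\<close> is, appending one of them turns it into a suitable \<open>Q\<close>
  (\<open>dense_generator_extension\<close>).  If some cycle has a rotation \<open>B\<close> of infinite order, then for every
  rotation \<open>T\<close> one of \<open>T\<close> and \<open>TB\<close> has infinite order, and the powers of a rotation of infinite order
  are dense in the circle.  Otherwise all rotations of cycles are torsion elements of a finitely
  generated abelian group, hence there are finitely many of them.  They form a cyclic group, and the
  orthogonal parts of cycles already form the whole transformation group, so that every \<open>T\<close> can be
  completed to a generator.
\<close>

section \<open>Plane isometries and complex numbers\<close>

text \<open>
  The first column determines an orthogonal matrix up to its determinant.  Read as a complex number
  it is the unit number \<open>u\<close> for which the matrix acts as \<open>z \<mapsto> u z\<close> or \<open>z \<mapsto> u cnj z\<close>.
\<close>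

definition first_col :: "real^2^2 \<Rightarrow> complex" where
  "first_col A = Complex (A $ 1 $ 1) (A $ 2 $ 1)"

definition rot :: "complex \<Rightarrow> real^2^2" where
  "rot u = vector [vector [Re u, - Im u], vector [Im u, Re u]]"

lemma rot_nth: "rot u $ 1 $ 1 = Re u" "rot u $ 1 $ 2 = - Im u" "rot u $ 2 $ 1 = Im u" "rot u $ 2 $ 2 = Re u"
  by (simp_all add: rot_def)

lemma first_col_rot [simp]: "first_col (rot u) = u"
  by (simp add: first_col_def rot_nth)

lemma mat2_eq_iff: "A = B \<longleftrightarrow> A$1$1 = B$1$1 \<and> A$1$2 = B$1$2 \<and> A$2$1 = B$2$1 \<and> A$2$2 = (B::real^2^2)$2$2"
  by (auto simp: vec_eq_iff forall_2)

lemma rot_mult: "rot (u * v) = rot u ** rot v"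
  by (simp add: mat2_eq_iff rot_nth matrix_matrix_mult_def sum_2)

lemma rot_one: "rot 1 = mat 1"
  by (simp add: mat2_eq_iff rot_nth mat_def)

lemma orthogonal_matrix_entries:
  fixes A :: "real^2^2"
  assumes "orthogonal_matrix A"
  shows "(A$1$1)\<^sup>2 + (A$2$1)\<^sup>2 = 1" 
    and "A$1$2 = - det A * A$2$1" and "A$2$2 = det A * A$1$1"
proof -
  have "transpose A ** A = mat 1" using assms by (simp add: orthogonal_matrix_def)
  hence e: "(A$1$1)*(A$1$1) + (A$2$1)*(A$2$1) = 1" "(A$1$1)*(A$1$2) + (A$2$1)*(A$2$2) = 0"
    by (simp_all add: mat2_eq_iff matrix_matrix_mult_def sum_2 transpose_def mat_def)
  show "(A$1$1)\<^sup>2 + (A$2$1)\<^sup>2 = 1" using e by (simp add: power2_eq_square)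
  show "A$1$2 = - det A * A$2$1" "A$2$2 = det A * A$1$1"
    unfolding det_2 using e by algebra+
qed

lemma norm_first_col: "orthogonal_matrix A \<Longrightarrow> norm (first_col A) = 1"
  using orthogonal_matrix_entries(1)[of A] by (simp add: first_col_def cmod_def)

lemma orthogonal_matrix_eqI:
  assumes "orthogonal_matrix A" "orthogonal_matrix B" "det A = det B" "first_col A = first_col B"
  shows "A = B"
  using assms orthogonal_matrix_entries[of A] orthogonal_matrix_entries[of B]
  by (simp add: mat2_eq_iff first_col_def)

text \<open>
  Multiplicativity up to conjugation: this is what makes linear parts of paths accessible to
  commutative arguments.
\<close>

lemma first_col_mult:
  assumes "orthogonal_matrix A"
  shows "first_col (A ** B) = first_col A * (if det A = 1 then first_col B else cnj (first_col B))"
  using orthogonal_matrix_entries[OF assms] det_orthogonal_matrix[OF assms]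
  by (auto simp: first_col_def matrix_matrix_mult_def sum_2 complex_eq_iff)

lemma first_col_mat_1 [simp]: "first_col (mat 1) = 1"
  by (simp add: first_col_def mat_def complex_eq_iff)

lemma rot_first_col: "A \<in> SO2 \<Longrightarrow> rot (first_col A) = A"
  using orthogonal_matrix_entries[of A]
  by (auto simp: SO2_def rotation_matrix_def mat2_eq_iff rot_nth first_col_def)

lemma SO2_iff: "A \<in> SO2 \<longleftrightarrow> orthogonal_matrix A \<and> det A = 1"
  by (simp add: SO2_def rotation_matrix_def)

lemma first_col_mult_SO2: "A \<in> SO2 \<Longrightarrow> first_col (A ** B) = first_col A * first_col B"
  by (simp add: first_col_mult SO2_iff)

lemma continuous_rot: "continuous_on UNIV rot"
proof -
  have eq: "rot = (\<lambda>u. \<chi> i j. if i = 1 then (if j = 1 then Re u else - Im u) else (if j = 1 then Im u else Re u))"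
    by (rule ext) (simp add: mat2_eq_iff rot_nth)
  show ?thesis unfolding eq
  proof (intro continuous_on_vec_lambda)
    fix i j :: 2
    show "continuous_on UNIV (\<lambda>u. if i = 1 then if j = 1 then Re u else - Im u else if j = 1 then Im u else Re u)"
      by (cases "i = 1"; cases "j = 1") (auto intro!: continuous_intros)
  qed
qed

lemma rot_power_in_generate: "Q \<in> SO2 \<Longrightarrow> rot (first_col Q ^ k) \<in> generate O2 {Q}"
proof (induction k)
  case 0 
  have "\<one>\<^bsub>O2\<^esub> \<in> generate O2 {Q}" by (rule generate.one)
  then show ?case by (simp add: rot_one O2_def)
next
  case (Suc k)
  have "Q \<otimes>\<^bsub>O2\<^esub> rot (first_col Q ^ k) \<in> generate O2 {Q}"
    using Suc by (intro generate.eng[OF generate.incl]) auto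
  then show ?case using Suc.prems by (simp add: rot_mult rot_first_col O2_def)
qed

lemma subgroup_SO2: "subgroup SO2 O2"
proof -
  interpret O2: group O2 by (rule group_O2)
  show ?thesis
  proof (rule O2.subgroupI)
    show "SO2 \<subseteq> carrier O2" by (auto simp: SO2_iff O2_def)
    have "mat 1 \<in> SO2" by (simp add: SO2_iff orthogonal_matrix_id)
    then show "SO2 \<noteq> {}" by blast
    fix A assume A: "A \<in> SO2"
    have "inv\<^bsub>O2\<^esub> A = transpose A"
      using A by (intro O2.inv_equality) (auto simp: SO2_iff O2_def orthogonal_matrix_def)
    then show "inv\<^bsub>O2\<^esub> A \<in> SO2" using A by (simp add: SO2_iff orthogonal_matrix_def)
    fix B assume "B \<in> SO2"
    then show "A \<otimes>\<^bsub>O2\<^esub> B \<in> SO2" using A by (simp add: SO2_iff O2_def orthogonal_matrix_mul det_mul)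
  qed
qed

section \<open>Torsion in finitely generated groups of complex numbers\<close>

lemma power_int_prod: "(\<Prod>a\<in>A. f a) powi i = (\<Prod>a\<in>A. f a powi i)" for f :: "'a \<Rightarrow> 'b::field"
  by (induction A rule: infinite_finite_induct) (simp_all add: power_int_mult_distrib)

text \<open>
  The torsion subgroup of a finitely generated abelian group has finite exponent; here the group is
  written as the set of all products of integer powers of the generators \<open>A\<close>.  When a generator \<open>a\<close> is
  added, either some positive power \<open>a\<^sup>k\<close> lies in the group generated by \<open>A\<close>, so that \<open>k\<close>-th powers
  reduce to that group, or no torsion element can involve \<open>a\<close> at all.
\<close>

lemma torsion_exponent:
  fixes A :: "complex set"
  assumes "finite A" "0 \<notin> A"
  shows "\<exists>D>0. \<forall>n :: complex \<Rightarrow> int. \<forall>N>0. (\<Prod>a\<in>A. a powi n a) ^ N = 1 \<longrightarrow> (\<Prod>a\<in>A. a powi n a) ^ (D::nat) = 1"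
  using assms
proof (induction A rule: finite_induct)
  case empty
  then show ?case by (auto intro: exI[of _ 1])
next
  case (insert a A)
  then obtain D where D: "D > 0" 
    and DA: "\<And>n N. N > 0 \<Longrightarrow> (\<Prod>a\<in>A. a powi n a) ^ N = 1 \<Longrightarrow> (\<Prod>a\<in>A. a powi n a) ^ (D::nat) = 1"
    by auto
  have A0: "b \<noteq> 0" if "b \<in> A" for b using insert.prems that by auto
  have a0: "a \<noteq> 0" using insert.prems by auto
  have pw: "(\<Prod>b\<in>A. b powi n b) powi i = (\<Prod>b\<in>A. b powi (n b * i))" for n i
    by (simp add: power_int_prod power_int_mult)
  show ?case
  proof (cases "\<exists>k>0. \<exists>m. a ^ k = (\<Prod>b\<in>A. b powi m b)")
    case True
    then obtain k m where k: "k > 0" and m: "a ^ k = (\<Prod>b\<in>A. b powi m b)" by blast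
    show ?thesis
    proof (intro exI[of _ "k * D"] conjI allI impI)
      show "0 < k * D" using k D by simp
      fix n :: "complex \<Rightarrow> int" and N :: nat
      assume N: "N > 0" and t: "(\<Prod>a\<in>insert a A. a powi n a) ^ N = 1"
      let ?x = "\<Prod>a\<in>insert a A. a powi n a"
      have "?x ^ k = (a powi n a * (\<Prod>b\<in>A. b powi n b)) ^ k" using insert by simp
      also have "\<dots> = (a ^ k) powi n a * (\<Prod>b\<in>A. b powi n b) powi int k"
        by (simp add: power_mult_distrib power_int_power power_int_power' mult.commute)
      also have "\<dots> = (\<Prod>b\<in>A. b powi (m b * n a + n b * int k))"
        unfolding m pw using A0 by (simp add: prod.distrib[symmetric] power_int_add)
      finally have e: "?x ^ k = (\<Prod>b\<in>A. b powi (m b * n a + n b * int k))" .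
      have "(?x ^ k) ^ N = 1" using t by (metis power_mult mult.commute power_one)
      with N have "(?x ^ k) ^ D = 1" unfolding e by (rule DA)
      then show "?x ^ (k * D) = 1" by (simp add: power_mult)
    qed
  next
    case False
    show ?thesis
    proof (intro exI[of _ D] conjI allI impI)
      show "0 < D" by fact
      fix n :: "complex \<Rightarrow> int" and N :: nat
      assume N: "N > 0" and t: "(\<Prod>a\<in>insert a A. a powi n a) ^ N = 1"
      have eq: "(\<Prod>a\<in>insert a A. a powi n a) = a powi n a * (\<Prod>b\<in>A. b powi n b)" using insert by simp
      have P0: "(\<Prod>b\<in>A. b powi n b) \<noteq> 0" using A0 insert.hyps by auto
      have one: "a powi (n a * int N) * (\<Prod>b\<in>A. b powi n b) powi int N = 1"
        using t unfolding eq by (simp add: power_mult_distrib power_int_power')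
      have "n a = 0"
      proof (rule ccontr)
        assume "n a \<noteq> 0"
        define k where "k = nat \<bar>n a * int N\<bar>"
        have k: "k > 0" using \<open>n a \<noteq> 0\<close> N by (simp add: k_def)
        have *: "a powi (n a * int N) = (\<Prod>b\<in>A. b powi n b) powi (- int N)"
          using one P0 by (simp add: power_int_minus field_simps)
        have **: "a powi (- (n a * int N)) = (\<Prod>b\<in>A. b powi n b) powi (int N)"
          using one P0 a0 by (simp add: power_int_minus field_simps)
        have "a ^ k = a powi (int k)" by simp
        also have "int k = n a * int N \<or> int k = - (n a * int N)" by (auto simp: k_def)
        then have "\<exists>j. a powi (int k) = (\<Prod>b\<in>A. b powi n b) powi j" using * ** by metis
        finally show False using False k pw by metis
      qed
      then have "(\<Prod>a\<in>insert a A. a powi n a) = (\<Prod>b\<in>A. b powi n b)" using eq by simp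
      with t N show "(\<Prod>a\<in>insert a A. a powi n a) ^ D = 1" using DA by metis
    qed
  qed
qed

section \<open>Subsets of the circle\<close>

text \<open>
  Multiplication by an element permutes \<open>H\<close>, so every element is an \<open>n\<close>-th root of unity with
  \<open>n = card H\<close>.  There are only \<open>n\<close> of those, hence \<open>H\<close> consists of all of them.
\<close>

lemma finite_circle_submonoid_cyclic:
  fixes H :: "complex set"
  assumes fin: "finite H" "H \<noteq> {}" and nz: "0 \<notin> H" and mult: "\<And>x y. x \<in> H \<Longrightarrow> y \<in> H \<Longrightarrow> x * y \<in> H"
  shows "\<exists>g\<in>H. H = range (\<lambda>k::nat. g ^ k)"
proof -
  define n where "n = card H"
  have n: "n > 0" using fin by (simp add: n_def card_gt_0_iff)
  have pow: "x ^ n = 1" if x: "x \<in> H" for x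
  proof -
    have x0: "x \<noteq> 0" using x nz by auto
    have inj: "inj_on ((*) x) H" using x0 by (simp add: inj_on_def)
    have "(*) x ` H = H"
      by (rule endo_inj_surj[OF fin(1) _ inj]) (use mult x in auto)
    then have "(\<Prod>y\<in>H. y) = (\<Prod>y\<in>(*) x ` H. y)" by simp
    also have "\<dots> = (\<Prod>y\<in>H. x * y)" using inj by (simp add: prod.reindex)
    also have "\<dots> = x ^ n * (\<Prod>y\<in>H. y)" by (simp add: prod.distrib n_def)
    finally show ?thesis using fin nz by (metis mult_cancel_right1 prod_zero_iff)
  qed
  have H: "H = {z. z ^ n = 1}"
  proof (rule card_subset_eq)
    show "finite {z::complex. z ^ n = 1}" using n by (intro finite_roots_unity) auto
    show "H \<subseteq> {z. z ^ n = 1}" using pow by auto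
    show "card H = card {z::complex. z ^ n = 1}" using n by (simp add: card_roots_unity_eq n_def)
  qed
  define g where "g = cis (2 * pi / real n)"
  have gk: "g ^ k = cis (2 * pi * real k / real n)" for k
    unfolding g_def Complex.DeMoivre by (rule arg_cong[of _ _ cis]) simp
  have "bij_betw (\<lambda>k. cis (2 * pi * real k / real n)) {..<n} {z. z ^ n = 1}"
    by (rule Complex.bij_betw_roots_unity[OF n])
  then have "{z. z ^ n = 1} = (\<lambda>k. g ^ k) ` {..<n}" by (simp add: bij_betw_def gk)
  moreover have "g \<in> H" unfolding H using n by (simp add: gk cis_2pi) 
  moreover have "g ^ k \<in> H" for k using \<open>g \<in> H\<close> unfolding H by (simp add: power_mult[symmetric] mult.commute[of k]) (simp add: power_mult)
  ultimately show ?thesis using H by blast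
qed

text \<open>
  Kronecker's approximation theorem, transported to the circle.
\<close>

lemma powers_dense_in_circle:
  fixes u w :: complex
  assumes u: "norm u = 1" and inf: "\<And>k::nat. k > 0 \<Longrightarrow> u ^ k \<noteq> 1" and w: "norm w = 1"
  shows "w \<in> closure (range (\<lambda>k::nat. u ^ k))"
proof -
  obtain a where a: "u = cis (2 * pi * a)" 
    using u by (metis (no_types, opaque_lifting) complex_norm_eq_1_exp cis_conv_exp mult.commute nonzero_mult_div_cancel_left pi_neq_zero times_divide_eq_right zero_neq_numeral mult_eq_0_iff)
  obtain b where b: "w = cis (2 * pi * b)" 
    using w by (metis (no_types, opaque_lifting) complex_norm_eq_1_exp cis_conv_exp mult.commute nonzero_mult_div_cancel_left pi_neq_zero times_divide_eq_right zero_neq_numeral mult_eq_0_iff)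
  have irr: "a \<notin> \<rat>"
  proof
    assume "a \<in> \<rat>"
    then obtain p q where q: "q > 0" "a = of_int p / of_int q" by (metis Rats_cases')
    have "real (nat q) * (2 * pi * a) = 2 * pi * of_int p" using q by (simp add: field_simps)
    then have "u ^ nat q = cis (2 * pi * of_int p)" unfolding a Complex.DeMoivre by (simp only:)
    also have "\<dots> = 1" by (simp add: complex_eq_iff cos_int_2pin sin_int_2pin)
    finally show False using inf[of "nat q"] q by simp
  qed
  show ?thesis unfolding closure_approachable
  proof (intro allI impI)
    fix e :: real assume e: "e > 0"
    have "isCont (\<lambda>x. cis (2 * pi * x)) 0" unfolding cis_conv_exp by (intro continuous_intros)
    then obtain d where d: "d > 0" "\<And>x. \<bar>x\<bar> < d \<Longrightarrow> dist (cis (2 * pi * x)) 1 < e"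
      using e unfolding continuous_at_eps_delta by (auto simp: dist_norm)
    obtain h k where hk: "k > 0" "\<bar>of_int k * a - of_int h - b\<bar> < d"
      using sequence_of_fractional_parts_is_dense[OF irr d(1), of b] by metis
    have "u ^ nat k = cis (2 * pi * (of_int k * a - of_int h - b)) * w * cis (2 * pi * of_int h)"
      using hk unfolding a b Complex.DeMoivre cis_mult by (simp add: algebra_simps)
    also have "cis (2 * pi * of_int h) = 1" by (simp add: complex_eq_iff cos_int_2pin sin_int_2pin)
    finally have "u ^ nat k - w = (cis (2 * pi * (of_int k * a - of_int h - b)) - 1) * w" by (simp add: algebra_simps)
    then have "dist (u ^ nat k) w < e" using d(2)[OF hk(2)] w by (simp add: dist_norm norm_mult)
    then show "\<exists>y\<in>range (\<lambda>k. u ^ k). dist y w < e" by blast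
  qed
qed

section \<open>Estimating Hausdorff dimension\<close>

lemma hausdorff_dim_nonneg: "0 \<le> hausdorff_dim A"
  unfolding hausdorff_dim_def by (rule INF_greatest) auto

lemma diameter_leI:
  fixes U :: "'a::metric_space set"
  assumes "\<And>x y. x \<in> U \<Longrightarrow> y \<in> U \<Longrightarrow> dist x y \<le> d" "0 \<le> d"
  shows "diameter U \<le> d"
  using assms by (auto simp: diameter_def intro!: cSUP_least)

lemma diam_power_le:
  assumes "bounded U" "\<And>x y. x \<in> U \<Longrightarrow> y \<in> U \<Longrightarrow> dist x y \<le> d" "0 < s" "0 \<le> d"
  shows "diam_power s U \<le> ennreal (d powr s)"
proof -
  have "diameter U \<le> d" by (intro diameter_leI assms)
  then show ?thesis using assms diameter_ge_0[of U]
    by (auto simp: diam_power_def intro!: ennreal_leI powr_mono2)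
qed

lemma premeasure_le_card:
  fixes A :: "'a::metric_space set"
  assumes fin: "finite I" and cov: "A \<subseteq> (\<Union>i\<in>I. U i)" and d: "0 \<le> d" "d \<le> \<delta>" and s: "0 < s"
    and diam: "\<And>i x y. i \<in> I \<Longrightarrow> x \<in> U i \<Longrightarrow> y \<in> U i \<Longrightarrow> dist x y \<le> d"
  shows "hausdorff_premeasure s \<delta> A \<le> ennreal (real (card I) * d powr s)"
proof -
  obtain f where f: "bij_betw f {..<card I} I"
    using ex_bij_betw_nat_finite[OF fin] by (auto simp: atLeast0LessThan)
  define V where "V n = (if n < card I then U (f n) else {})" for n
  have fI: "f n \<in> I" if "n < card I" for n using f that by (auto simp: bij_betw_def)
  have Vd: "dist x y \<le> d" if "x \<in> V n" "y \<in> V n" for n x y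
    using that diam fI by (auto simp: V_def split: if_splits)
  have Vb: "bounded (V n)" for n
    using Vd by (metis bounded_def bounded_empty ex_in_conv)
  have "diameter (V n) \<le> d" for n
    by (intro diameter_leI Vd d)
  with d have Vdiam: "diameter (V n) \<le> \<delta>" for n by (meson order_trans)
  have "A \<subseteq> (\<Union>n. V n)"
  proof
    fix x assume "x \<in> A"
    then obtain i where i: "i \<in> I" "x \<in> U i" using cov by auto
    then obtain n where "n < card I" "f n = i" by (metis bij_betw_imp_surj_on[OF f] imageE lessThan_iff)
    then have "x \<in> V n" using i by (auto simp: V_def)
    then show "x \<in> (\<Union>n. V n)" by blast
  qed
  then have "hausdorff_premeasure s \<delta> A \<le> (\<Sum>n. diam_power s (V n))"
    unfolding hausdorff_premeasure_def by - (rule INF_lower, simp add: Vb Vdiam)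
  also have "\<dots> = (\<Sum>n<card I. diam_power s (V n))"
    by (rule suminf_finite) (auto simp: V_def diam_power_def)
  also have "\<dots> \<le> (\<Sum>n<card I. ennreal (d powr s))"
    by (intro sum_mono diam_power_le Vb Vd s d)
  also have "\<dots> = ennreal (real (card I) * d powr s)"
    by (simp add: ennreal_mult ennreal_of_nat_eq_real_of_nat)
  finally show ?thesis .
qed

text \<open>
  In a maximal disjoint subfamily \<open>I\<close> every piece meets a member of \<open>I\<close>, so the closed
  \<open>d\<close>-neighbourhoods of the members cover everything.  A large premeasure thus forces many disjoint
  pieces.
\<close>

lemma packing_cover:
  fixes C :: "'b \<Rightarrow> 'a::metric_space set"
  assumes W: "finite W" and cov: "A \<subseteq> (\<Union>p\<in>W. C p)" and ne: "\<And>p. p \<in> W \<Longrightarrow> C p \<noteq> {}"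
    and diam: "\<And>p x y. p \<in> W \<Longrightarrow> x \<in> C p \<Longrightarrow> y \<in> C p \<Longrightarrow> dist x y \<le> d"
    and d: "0 \<le> d" "3 * d \<le> \<delta>" and s: "0 < s"
  shows "\<exists>I\<subseteq>W. disjoint_family_on C I \<and> hausdorff_premeasure s \<delta> A \<le> ennreal (real (card I) * (3 * d) powr s)"
proof -
  define D where "D = {I. I \<subseteq> W \<and> disjoint_family_on C I}"
  have "finite D" using W by (auto simp: D_def)
  moreover have "{} \<in> D" by (simp add: D_def disjoint_family_on_def)
  ultimately obtain I where I: "I \<in> D" "\<And>J. J \<in> D \<Longrightarrow> I \<subseteq> J \<Longrightarrow> I = J"
    using finite_has_maximal[of D] by blast
  define U where "U p = {x. \<exists>y\<in>C p. dist x y \<le> d}" for p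
  have IW: "I \<subseteq> W" and Idisj: "disjoint_family_on C I" using I(1) by (auto simp: D_def)
  have meets: "\<exists>q\<in>I. C p \<inter> C q \<noteq> {}" if p: "p \<in> W" for p
  proof (rule ccontr)
    assume no: "\<not> (\<exists>q\<in>I. C p \<inter> C q \<noteq> {})"
    then have "disjoint_family_on C (insert p I)" using Idisj by (auto simp: disjoint_family_on_def)
    then have "insert p I \<in> D" using p IW by (simp add: D_def)
    then have "p \<in> I" using I(2)[of "insert p I"] by blast
    then show False using no ne[OF p] by auto
  qed
  have "hausdorff_premeasure s \<delta> A \<le> ennreal (real (card I) * (3 * d) powr s)"
  proof (rule premeasure_le_card)
    show "finite I" using IW W by (rule finite_subset)
    show "A \<subseteq> (\<Union>q\<in>I. U q)"
    proof
      fix x assume "x \<in> A"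
      then obtain p where p: "p \<in> W" "x \<in> C p" using cov by blast
      then obtain q y where "q \<in> I" "y \<in> C p" "y \<in> C q" using meets by blast
      then show "x \<in> (\<Union>q\<in>I. U q)" using diam[OF p(1) p(2)] by (auto simp: U_def)
    qed
    show "dist x y \<le> 3 * d" if pq: "p \<in> I" "x \<in> U p" "y \<in> U p" for p x y
    proof -
      obtain x' y' where "x' \<in> C p" "y' \<in> C p" "dist x x' \<le> d" "dist y y' \<le> d" using pq by (auto simp: U_def)
      moreover from this have "dist x' y' \<le> d" using diam pq(1) IW by blast
      moreover have "dist x y \<le> dist x x' + dist x' y' + dist y y'" by metric
      ultimately show ?thesis by simp
    qed
  qed (use d s in auto)
  then show ?thesis using IW Idisj by blast
qed

lemma dim_le_if_small_covers:
  assumes s: "0 < s" 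
    and small: "\<And>\<delta> e. 0 < \<delta> \<Longrightarrow> 0 < e \<Longrightarrow> hausdorff_premeasure s \<delta> A \<le> ennreal e"
  shows "hausdorff_dim A \<le> ereal s"
proof -
  have "hausdorff_premeasure s \<delta> A = 0" if "\<delta> > 0" for \<delta>
  proof -
    have "hausdorff_premeasure s \<delta> A \<le> 0 + ennreal e" if "0 < e" for e
      using small[OF \<open>\<delta> > 0\<close> that] by simp
    then have "hausdorff_premeasure s \<delta> A \<le> 0"
      by (rule ennreal_le_epsilon)
    then show ?thesis by simp
  qed
  then have "hausdorff_measure s A \<le> 0"
    unfolding hausdorff_measure_def by (intro SUP_least) simp
  then show ?thesis unfolding hausdorff_dim_def using s by (intro INF_lower) simp
qed

lemma premeasure_pos_below_dim:
  assumes "0 \<le> s" "ereal s < hausdorff_dim A"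
  obtains \<delta> h where "0 < \<delta>" "0 < h" "ennreal h \<le> hausdorff_premeasure s \<delta> A"
proof -
  have "hausdorff_measure s A \<noteq> 0"
  proof
    assume "hausdorff_measure s A = 0"
    then have "hausdorff_dim A \<le> ereal s"
      unfolding hausdorff_dim_def using assms(1) by (intro INF_lower) auto
    with assms(2) show False by simp
  qed
  then have "0 < hausdorff_measure s A" by (simp add: zero_less_iff_neq_zero)
  then obtain \<delta> where d: "\<delta> > 0" "0 < hausdorff_premeasure s \<delta> A"
    unfolding hausdorff_measure_def less_SUP_iff by auto
  then obtain h where h: "0 < h" "h < hausdorff_premeasure s \<delta> A" using dense by blast
  show ?thesis
  proof (cases h rule: ennreal_cases)
    case (real x)
    then show ?thesis using d h that[of \<delta> x] by auto
  qed (use h in auto)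
qed

text \<open>
  The diameters of the covering sets are unrestricted here: for compact self-similar sets a lower
  bound that is uniform in the scale is available.
\<close>

lemma le_hausdorff_dimI:
  fixes A :: "'a::metric_space set"
  assumes "\<And>s. 0 \<le> s \<Longrightarrow> s < t \<Longrightarrow> \<exists>c>0. \<forall>U :: nat \<Rightarrow> 'a set.
      A \<subseteq> (\<Union>i. U i) \<longrightarrow> (\<forall>i. bounded (U i)) \<longrightarrow> ennreal c \<le> (\<Sum>i. diam_power s (U i))"
  shows "ereal t \<le> hausdorff_dim A"
  unfolding hausdorff_dim_def
proof (rule INF_greatest, clarsimp)
  fix s assume s: "0 \<le> s" "hausdorff_measure s A = 0"
  show "t \<le> s"
  proof (rule ccontr)
    assume "\<not> t \<le> s"
    then obtain c where c: "c > 0" "\<And>U :: nat \<Rightarrow> 'a set. A \<subseteq> (\<Union>i. U i) \<Longrightarrow> (\<forall>i. bounded (U i)) \<Longrightarrow> ennreal c \<le> (\<Sum>i. diam_power s (U i))"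
      using assms[of s] s(1) by force
    have "ennreal c \<le> hausdorff_premeasure s 1 A"
      unfolding hausdorff_premeasure_def by (rule INF_greatest) (use c in auto)
    also have "\<dots> \<le> hausdorff_measure s A" unfolding hausdorff_measure_def by (rule SUP_upper) auto
    finally show False using c s by simp
  qed
qed

text \<open>
  Passing to open sets with positive diameter bounds costs arbitrarily little.  This makes finite
  subcovers available and avoids the separate conventions for \<open>diam_power\<close> in the case \<open>s = 0\<close>.
\<close>

lemma diam_power_enlarge:
  fixes U :: "'a::metric_space set"
  assumes "bounded U" "0 \<le> s" "0 < e"
  obtains V d where "open V" "U \<subseteq> V" "0 < d" "\<And>x y. x \<in> V \<Longrightarrow> y \<in> V \<Longrightarrow> dist x y \<le> d"
    "U = {} \<longrightarrow> V = {}" "U \<noteq> {} \<longrightarrow> ennreal (d powr s) \<le> diam_power s U + ennreal e"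
proof (cases "U = {}")
  case True
  then show ?thesis using that[of "{}" 1] by auto
next
  case False
  define D where "D = diameter U"
  have D: "D \<ge> 0" using assms diameter_ge_0 by (auto simp: D_def)
  have "\<exists>\<eta>>0. s = 0 \<or> (D + 2 * \<eta>) powr s \<le> D powr s + e"
  proof (cases "s = 0")
    case True then show ?thesis by (auto intro: exI[of _ 1])
  next
    case False
    then have "s > 0" using assms by simp
    have "((\<lambda>\<eta>. (D + 2 * \<eta>) powr s) \<longlongrightarrow> (D + 2 * 0) powr s) (at_right 0)"
      using \<open>s > 0\<close> D
      by (intro tendsto_powr' tendsto_intros disjI2 conjI
          eventually_mono[OF eventually_at_right_less[of "0::real"]]) auto
    then have "eventually (\<lambda>\<eta>. (D + 2 * \<eta>) powr s < D powr s + e) (at_right 0)"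
      using assms(3) by (intro order_tendstoD) auto
    then have "eventually (\<lambda>\<eta>. (D + 2 * \<eta>) powr s < D powr s + e \<and> \<eta> > 0) (at_right 0)"
      using eventually_at_right_less[of 0] by (rule eventually_conj)
    then obtain \<eta> where "(D + 2 * \<eta>) powr s < D powr s + e \<and> \<eta> > 0"
      using eventually_happens[of _ "at_right (0::real)"] by (auto simp: trivial_limit_at_right_real)
    then show ?thesis by (intro exI[of _ \<eta>]) auto
  qed
  then obtain \<eta> where \<eta>: "\<eta> > 0" "s = 0 \<or> (D + 2 * \<eta>) powr s \<le> D powr s + e" by blast
  define V where "V = (\<Union>x\<in>U. ball x \<eta>)"
  show ?thesis
  proof (rule that[of V "D + 2 * \<eta>"])
    show "open V" "U \<subseteq> V" "0 < D + 2 * \<eta>" using \<eta> D by (auto simp: V_def)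
    show "U = {} \<longrightarrow> V = {}" using False by simp
    fix x y assume "x \<in> V" "y \<in> V"
    then obtain x' y' where xy: "x' \<in> U" "y' \<in> U" "dist x' x < \<eta>" "dist y' y < \<eta>" by (auto simp: V_def)
    have "dist x y \<le> dist x' x + dist x' y' + dist y' y"
      by metric
    also have "dist x' y' \<le> D" unfolding D_def by (rule diameter_bounded_bound) (use xy assms in auto)
    finally show "dist x y \<le> D + 2 * \<eta>" using xy by simp
  next
    show "U \<noteq> {} \<longrightarrow> ennreal ((D + 2 * \<eta>) powr s) \<le> diam_power s U + ennreal e"
    proof (cases "s = 0")
      case True
      have "1 + ennreal e \<ge> 1 + 0" by (intro add_left_mono) simp
      then show ?thesis using True False D \<eta> by (simp add: diam_power_def)
    next
      case False
      with \<eta> show ?thesis using \<open>U \<noteq> {}\<close> assms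
        by (simp add: diam_power_def D_def[symmetric] ennreal_plus[symmetric] ennreal_leI del: ennreal_plus)
    qed
  qed
qed

text \<open>
  By compactness only finite covers have to be estimated.
\<close>

lemma diam_power_sum_lower_bound:
  fixes A :: "'a::metric_space set"
  assumes comp: "compact A" and s: "0 \<le> s" and c: "0 < c"
    and fin: "\<And>(I::nat set) U d. finite I \<Longrightarrow> A \<subseteq> (\<Union>i\<in>I. U i) \<Longrightarrow> (\<And>i. i \<in> I \<Longrightarrow> 0 < d i) \<Longrightarrow>
      (\<And>i x y. i \<in> I \<Longrightarrow> x \<in> U i \<Longrightarrow> y \<in> U i \<Longrightarrow> dist x y \<le> d i) \<Longrightarrow> c \<le> (\<Sum>i\<in>I. d i powr s)"
    and cov: "A \<subseteq> (\<Union>i. U i)" and bd: "\<And>i. bounded (U i)"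
  shows "ennreal (c / 2) \<le> (\<Sum>i. diam_power s (U i))"
proof -
  \<comment> \<open>errors with total \<open>c / 2\<close>\<close>
  define e where "e i = c / 2 * (1 / 2) ^ Suc i" for i
  have e: "e i > 0" for i using c by (simp add: e_def)
  have "\<exists>V d. open V \<and> U i \<subseteq> V \<and> 0 < d \<and> (\<forall>x\<in>V. \<forall>y\<in>V. dist x y \<le> d) \<and>
    (U i = {} \<longrightarrow> V = {}) \<and> (U i \<noteq> {} \<longrightarrow> ennreal (d powr s) \<le> diam_power s (U i) + ennreal (e i))" for i
    by (rule diam_power_enlarge[OF bd[of i] s e[of i]]) blast
  then obtain V d where V: "\<And>i. open (V i)" "\<And>i. U i \<subseteq> V i" "\<And>i. 0 < d i"
     "\<And>i x y. x \<in> V i \<Longrightarrow> y \<in> V i \<Longrightarrow> dist x y \<le> d i" "\<And>i. U i = {} \<Longrightarrow> V i = {}"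
     "\<And>i. U i \<noteq> {} \<Longrightarrow> ennreal (d i powr s) \<le> diam_power s (U i) + ennreal (e i)"
    by metis
  have "A \<subseteq> (\<Union>i\<in>UNIV. V i)" using cov V(2) by blast
  then obtain I0 where I0: "finite I0" "A \<subseteq> (\<Union>i\<in>I0. V i)"
    using compactE_image[OF comp, of UNIV V] V(1) by auto
  define I where "I = {i\<in>I0. U i \<noteq> {}}"
  have I: "finite I" "A \<subseteq> (\<Union>i\<in>I. V i)" using I0 V(5) by (fastforce simp: I_def)+
  have esum: "(\<Sum>i\<in>I. e i) \<le> c / 2"
  proof -
    have "e sums (c / 2 * 1)" unfolding e_def by (intro sums_mult power_half_series)
    then have "(\<Sum>i\<in>I. e i) \<le> c / 2 * 1" using e I(1)
      by (metis less_imp_le sum_le_suminf sums_iff)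
    then show ?thesis by simp
  qed
  have "ennreal c \<le> ennreal (\<Sum>i\<in>I. d i powr s)"
    using fin[OF I, of d] V by (intro ennreal_leI) auto
  also have "\<dots> = (\<Sum>i\<in>I. ennreal (d i powr s))" by (simp add: sum_ennreal)
  also have "\<dots> \<le> (\<Sum>i\<in>I. diam_power s (U i) + ennreal (e i))"
    by (intro sum_mono V(6)) (auto simp: I_def)
  also have "\<dots> = (\<Sum>i\<in>I. diam_power s (U i)) + ennreal (\<Sum>i\<in>I. e i)"
    using e by (simp add: sum.distrib sum_ennreal less_imp_le)
  also have "\<dots> \<le> (\<Sum>i. diam_power s (U i)) + ennreal (c / 2)"
    using I(1) esum by (intro add_mono ennreal_leI sum_le_suminf) auto
  finally have *: "ennreal (c / 2) + ennreal (c / 2) \<le> (\<Sum>i. diam_power s (U i)) + ennreal (c / 2)"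
    using c by (simp add: ennreal_plus[symmetric] del: ennreal_plus)
  show ?thesis using ennreal_add_left_cancel_le[of "ennreal (c/2)" "ennreal (c/2)"] * by (simp add: add.commute)
qed

section \<open>Homogeneous self-similar sets\<close>

text \<open>
  Induction on the number of covering sets.  If all of them are smaller than the gap \<open>\<delta>\<close>, each meets at
  most one of the copies \<open>F a ` L\<close>.  The sets that meet a given copy are then fewer than before, because
  there are at least two copies, and pulled back along \<open>F a\<close> they cover \<open>L\<close> with weight multiplied by
  \<open>r powr (- s)\<close>.  Summing over the copies does not decrease the bound, as \<open>card M * r powr s \<ge> 1\<close>.
\<close>

lemma homogeneous_cover_weight:
  fixes L :: "'a::metric_space set" and F :: "'b \<Rightarrow> 'a \<Rightarrow> 'a"
  assumes M: "finite M" "2 \<le> card M" and L: "L \<noteq> {}"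
    and r: "0 < r" and FL: "\<And>a. a \<in> M \<Longrightarrow> F a ` L \<subseteq> L"
    and sim: "\<And>a x y. a \<in> M \<Longrightarrow> dist (F a x) (F a y) = r * dist x y"
    and sep: "\<And>a b x y. a \<in> M \<Longrightarrow> b \<in> M \<Longrightarrow> a \<noteq> b \<Longrightarrow> x \<in> L \<Longrightarrow> y \<in> L \<Longrightarrow> \<delta> \<le> dist (F a x) (F b y)"
    and \<delta>: "0 < \<delta>" and s: "0 \<le> s" and mr: "1 \<le> real (card M) * r powr s"
    and I: "finite (I :: nat set)" and cov: "L \<subseteq> (\<Union>i\<in>I. U i)" and d: "\<And>i. i \<in> I \<Longrightarrow> 0 < d i"
    and Ud: "\<And>i x y. i \<in> I \<Longrightarrow> x \<in> U i \<Longrightarrow> y \<in> U i \<Longrightarrow> dist x y \<le> d i"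
  shows "\<delta> powr s \<le> (\<Sum>i\<in>I. d i powr s)"
  using I cov d Ud
proof (induction "card I" arbitrary: I U d rule: less_induct)
  case less
  show ?case
  proof (cases "\<exists>i\<in>I. \<delta> \<le> d i")
    case True
    then obtain i where i: "i \<in> I" "\<delta> \<le> d i" by blast
    then have "\<delta> powr s \<le> d i powr s" using \<delta> s by (intro powr_mono2) auto
    also have "\<dots> \<le> (\<Sum>i\<in>I. d i powr s)" using i less.prems(1) by (intro member_le_sum) auto
    finally show ?thesis .
  next
    case False
    define J where "J a = {i\<in>I. U i \<inter> F a ` L \<noteq> {}}" for a
    have Jfin: "finite (J a)" "J a \<subseteq> I" for a using less.prems(1) by (auto simp: J_def)
    have disj: "J a \<inter> J b = {}" if "a \<in> M" "b \<in> M" "a \<noteq> b" for a b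
    proof (rule ccontr)
      assume "J a \<inter> J b \<noteq> {}"
      then obtain i x y where i: "i \<in> I" "F a x \<in> U i" "F b y \<in> U i" "x \<in> L" "y \<in> L" by (auto simp: J_def)
      then have "\<delta> \<le> d i" using sep[OF that, of x y] less.prems(4)[of i "F a x" "F b y"] by simp
      then show False using False i by blast
    qed
    have Jne: "J a \<noteq> {}" if a: "a \<in> M" for a
    proof -
      obtain x where x: "x \<in> L" using L by blast
      then have "F a x \<in> L" using FL[OF a] by blast
      then obtain i where "i \<in> I" "F a x \<in> U i" using less.prems(2) by blast
      then show ?thesis using x by (auto simp: J_def)
    qed
    have sub: "\<delta> powr s * r powr s \<le> (\<Sum>i\<in>J a. d i powr s)" if a: "a \<in> M" for a
    proof -
      have "\<not> M \<subseteq> {a}" using M card_mono[of "{a}" M] by auto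
      then obtain b where b: "b \<in> M" "b \<noteq> a" by blast
      have "J a \<subset> I" using Jne[OF b(1)] disj[OF b(1) a b(2)] Jfin(2)[of b] Jfin(2)[of a] by blast
      then have lt: "card (J a) < card I" using less.prems(1) by (rule psubset_card_mono[rotated])
      have "\<delta> powr s \<le> (\<Sum>i\<in>J a. (d i / r) powr s)"
      proof (rule less.hyps[OF lt Jfin(1), of "\<lambda>i. F a -` U i"])
        show "L \<subseteq> (\<Union>i\<in>J a. F a -` U i)"
        proof
          fix x assume x: "x \<in> L"
          then have "F a x \<in> L" using FL[OF a] by blast
          then show "x \<in> (\<Union>i\<in>J a. F a -` U i)" using less.prems(2) x by (fastforce simp: J_def)
        qed
        show "0 < d i / r" if "i \<in> J a" for i using less.prems(3)[of i] that r Jfin(2)[of a] by (simp add: subset_iff)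
        show "dist x y \<le> d i / r" if "i \<in> J a" "x \<in> F a -` U i" "y \<in> F a -` U i" for i x y
          using less.prems(4)[of i "F a x" "F a y"] that Jfin(2)[of a] r sim[OF a, of x y]
          by (simp add: field_simps subset_iff)
      qed
      also have "\<dots> = (\<Sum>i\<in>J a. d i powr s) / r powr s"
        unfolding sum_divide_distrib
      proof (rule sum.cong[OF refl])
        fix i assume "i \<in> J a"
        then have "d i > 0" using less.prems(3) Jfin(2)[of a] by blast
        then show "(d i / r) powr s = d i powr s / r powr s" using r by (simp add: powr_divide)
      qed
      finally show ?thesis using r by (simp add: field_simps)
    qed
    have "\<delta> powr s * 1 \<le> \<delta> powr s * (real (card M) * r powr s)"
      using mr by (intro mult_left_mono) auto
    also have "\<dots> = (\<Sum>a\<in>M. \<delta> powr s * r powr s)" by simp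
    also have "\<dots> \<le> (\<Sum>a\<in>M. \<Sum>i\<in>J a. d i powr s)" by (intro sum_mono sub)
    also have "\<dots> = (\<Sum>i\<in>(\<Union>a\<in>M. J a). d i powr s)"
      using M(1) Jfin(1) disj by (subst sum.UNION_disjoint) auto
    also have "\<dots> \<le> (\<Sum>i\<in>I. d i powr s)"
      using Jfin less.prems(1) by (intro sum_mono2) auto
    finally show ?thesis by simp
  qed
qed

lemma compact_family_separated:
  fixes C :: "'b \<Rightarrow> 'a::heine_borel set"
  assumes "finite M" "\<And>a. a \<in> M \<Longrightarrow> compact (C a)" "disjoint_family_on C M"
  shows "\<exists>\<delta>>0. \<forall>a\<in>M. \<forall>b\<in>M. a \<noteq> b \<longrightarrow> (\<forall>x\<in>C a. \<forall>y\<in>C b. \<delta> \<le> dist x y)"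
proof -
  define P where "P = {(a, b). a \<in> M \<and> b \<in> M \<and> a \<noteq> b}"
  have "finite P" using finite_subset[of P "M \<times> M"] assms(1) by (auto simp: P_def)
  have "\<exists>\<delta>>0. \<forall>x\<in>C (fst p). \<forall>y\<in>C (snd p). \<delta> \<le> dist x y" if "p \<in> P" for p
    using that assms separate_compact_closed[of "C (fst p)" "C (snd p)"]
    by (auto simp: P_def disjoint_family_on_def compact_imp_closed)
  then obtain f where f: "\<And>p. p \<in> P \<Longrightarrow> f p > 0 \<and> (\<forall>x\<in>C (fst p). \<forall>y\<in>C (snd p). f p \<le> dist x y)"
    by metis
  define \<delta> where "\<delta> = Min (insert 1 (f ` P))"
  have "\<delta> > 0" unfolding \<delta>_def using f \<open>finite P\<close> by (subst Min_gr_iff) auto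
  moreover have "\<delta> \<le> f p" if "p \<in> P" for p unfolding \<delta>_def using that \<open>finite P\<close> by (intro Min_le) auto
  ultimately have "\<forall>p\<in>P. \<forall>x\<in>C (fst p). \<forall>y\<in>C (snd p). \<delta> \<le> dist x y" using f by (meson order_trans)
  then show ?thesis using \<open>\<delta> > 0\<close> unfolding P_def by (intro exI[of _ \<delta>]) auto
qed

lemma dim_homogeneous_ge:
  fixes L :: "'a::heine_borel set" and F :: "'b \<Rightarrow> 'a \<Rightarrow> 'a"
  assumes M: "finite M" and L: "compact L" "L \<noteq> {}"
    and r: "0 < r" "r < 1" and FL: "\<And>a. a \<in> M \<Longrightarrow> F a ` L \<subseteq> L"
    and sim: "\<And>a x y. a \<in> M \<Longrightarrow> dist (F a x) (F a y) = r * dist x y"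
    and disj: "disjoint_family_on (\<lambda>a. F a ` L) M"
    and mr: "1 \<le> real (card M) * r powr t"
  shows "ereal t \<le> hausdorff_dim L"
proof (rule le_hausdorff_dimI)
  fix s :: real assume s: "0 \<le> s" "s < t"
  have cM: "2 \<le> card M"
  proof (rule ccontr)
    assume "\<not> 2 \<le> card M"
    then have "real (card M) * r powr t \<le> 1 * r powr t" by (intro mult_right_mono) auto
    also have "\<dots> < 1" using r s powr_less_mono'[of r 0 t] by simp
    finally show False using mr by simp
  qed
  have comp: "compact (F a ` L)" if a: "a \<in> M" for a
  proof (rule compact_continuous_image[OF _ L(1)])
    have "r-lipschitz_on L (F a)" using sim[OF a] r by (auto simp: lipschitz_on_def)
    then show "continuous_on L (F a)" by (rule lipschitz_on_continuous_on)
  qed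
  obtain \<delta> where \<delta>: "\<delta> > 0" "\<And>a b x y. a \<in> M \<Longrightarrow> b \<in> M \<Longrightarrow> a \<noteq> b \<Longrightarrow> x \<in> L \<Longrightarrow> y \<in> L \<Longrightarrow> \<delta> \<le> dist (F a x) (F b y)"
    using compact_family_separated[OF M comp disj] by blast
  have "r powr t \<le> r powr s" using r s by (intro powr_mono') auto
  then have "real (card M) * r powr t \<le> real (card M) * r powr s" by (intro mult_left_mono) auto
  then have mr': "1 \<le> real (card M) * r powr s" using mr by simp
  show "\<exists>c>0. \<forall>U :: nat \<Rightarrow> 'a set. L \<subseteq> (\<Union>i. U i) \<longrightarrow> (\<forall>i. bounded (U i)) \<longrightarrow> ennreal c \<le> (\<Sum>i. diam_power s (U i))"
  proof (intro exI[of _ "\<delta> powr s / 2"] conjI allI impI)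
    show "0 < \<delta> powr s / 2" using \<delta> by simp
    fix U :: "nat \<Rightarrow> 'a set" assume U: "L \<subseteq> (\<Union>i. U i)" "\<forall>i. bounded (U i)"
    show "ennreal (\<delta> powr s / 2) \<le> (\<Sum>i. diam_power s (U i))"
    proof (rule diam_power_sum_lower_bound[OF L(1) s(1) _ _ U(1)])
      show "0 < \<delta> powr s" using \<delta> by simp
      show "bounded (U i)" for i using U by simp
      show "\<delta> powr s \<le> (\<Sum>i\<in>I. d i powr s)" 
        if "finite I" "L \<subseteq> (\<Union>i\<in>I. U i)" "\<And>i. i \<in> I \<Longrightarrow> 0 < d i"
          "\<And>i x y. i \<in> I \<Longrightarrow> x \<in> U i \<Longrightarrow> y \<in> U i \<Longrightarrow> dist x y \<le> d i" for I :: "nat set" and U d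
        by (rule homogeneous_cover_weight[OF M cM L(2) r(1) FL sim \<delta>(2,1) s(1) mr' that])
    qed
  qed
qed

text \<open>
  The attractor is the intersection of the iterated images of \<open>X\<close>.  Disjointness and injectivity make
  this intersection invariant: a point of all iterates has the same address letter and the same
  preimage at every level.
\<close>

lemma attractor_in_compact:
  fixes X :: "'a::{heine_borel} set" and F :: "'b \<Rightarrow> 'a \<Rightarrow> 'a"
  assumes M: "M \<noteq> {}" and X: "compact X" "X \<noteq> {}"
    and cont: "\<And>a. a \<in> M \<Longrightarrow> continuous_on UNIV (F a)" and inj: "\<And>a. a \<in> M \<Longrightarrow> inj (F a)"
    and sub: "\<And>a. a \<in> M \<Longrightarrow> F a ` X \<subseteq> X" and fin: "finite M"
    and disj: "disjoint_family_on (\<lambda>a. F a ` X) M"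
  shows "\<exists>L\<subseteq>X. L \<noteq> {} \<and> compact L \<and> L = (\<Union>a\<in>M. F a ` L)"
proof -
  define H where "H A = (\<Union>a\<in>M. F a ` A)" for A
  define Y where "Y n = (H ^^ n) X" for n
  have Y0: "Y 0 = X" and YS: "Y (Suc n) = H (Y n)" for n by (simp_all add: Y_def)
  have mono: "A \<subseteq> B \<Longrightarrow> H A \<subseteq> H B" for A B by (auto simp: H_def)
  have dec: "Y (Suc n) \<subseteq> Y n" for n
    by (induction n) (use sub mono in \<open>auto simp: YS Y0 H_def\<close>)
  have comp: "compact (Y n)" for n
  proof (induction n)
    case (Suc n)
    show ?case unfolding YS H_def
      by (intro compact_UN fin compact_continuous_image Suc continuous_on_subset[OF cont]) auto
  qed (use X Y0 in simp)
  have ne: "Y n \<noteq> {}" for n by (induction n) (use X M in \<open>auto simp: YS Y0 H_def\<close>)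
  have dec': "m \<le> n \<Longrightarrow> Y n \<subseteq> Y m" for m n using dec by (rule lift_Suc_antimono_le)
  define L where "L = (\<Inter>n. Y n)"
  have LX: "L \<subseteq> X" unfolding L_def using Y0 by blast
  have Lne: "L \<noteq> {}" unfolding L_def by (rule compact_nest[OF comp ne dec'])
  have Lc: "compact L" unfolding L_def using comp compact_imp_closed by (intro compact_Inter) auto
  have "H L \<subseteq> L"
  proof -
    have "H L \<subseteq> Y (Suc n)" for n unfolding YS by (rule mono) (auto simp: L_def)
    then have "H L \<subseteq> Y n" for n using dec by blast
    then show ?thesis unfolding L_def by blast
  qed
  moreover have "L \<subseteq> H L"
  proof
    fix x assume x: "x \<in> L"
    then have "\<exists>a\<in>M. \<exists>y\<in>Y n. x = F a y" for n
    proof -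
      have "x \<in> Y (Suc n)" using x by (auto simp: L_def)
      then show ?thesis by (auto simp: YS H_def)
    qed
    then obtain a y where ay: "\<And>n. a n \<in> M" "\<And>n. y n \<in> Y n" "\<And>n. x = F (a n) (y n)" by metis
    have yX: "y n \<in> X" for n using ay(2) dec'[of 0 n] Y0 by auto
    have "a n = a 0" for n using disj ay yX unfolding disjoint_family_on_def
      by (metis IntI empty_iff imageI)
    moreover from this have "y n = y 0" for n using ay inj by (metis injD)
    ultimately have "y 0 \<in> L" using ay(2) unfolding L_def by (metis INT_I)
    then show "x \<in> H L" using ay unfolding H_def by blast
  qed
  ultimately show ?thesis using LX Lne Lc unfolding H_def by blast
qed

section \<open>Compositions along paths\<close>

text \<open>
  The composition \<open>S\<^bsub>e1\<^esub> \<circ> \<dots> \<circ> S\<^bsub>ek\<^esub>\<close> along a path, kept as a similarity record so that it can serve as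
  a member of a self-similar system.
\<close>

primrec path_sim :: "('e \<Rightarrow> similarity) \<Rightarrow> 'e list \<Rightarrow> similarity" where
  "path_sim S [] = \<lparr>ratio = 1, orth = mat 1, transl = 0\<rparr>"
| "path_sim S (e # p) = \<lparr>ratio = ratio (S e) * ratio (path_sim S p),
     orth = orth (S e) ** orth (path_sim S p), transl = sim_map (S e) (transl (path_sim S p))\<rparr>"

lemma orth_path_sim [simp]: "orth (path_sim S p) = path_orth S p"
  by (induction p) (simp_all add: path_orth_def)

lemma path_orth_Nil [simp]: "path_orth S [] = mat 1" 
  and path_orth_Cons [simp]: "path_orth S (e # p) = orth (S e) ** path_orth S p"
  by (simp_all add: path_orth_def)

lemma path_orth_append: "path_orth S (p @ p') = path_orth S p ** path_orth S p'"
  by (induction p) (simp_all add: matrix_mul_assoc)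

lemma ratio_path_sim_append: "ratio (path_sim S (p @ p')) = ratio (path_sim S p) * ratio (path_sim S p')"
  by (induction p) simp_all

lemma sim_map_path_sim_Nil [simp]: "sim_map (path_sim S []) x = x"
  by (simp add: sim_map_def)

lemma sim_map_path_sim_Cons [simp]:
  "sim_map (path_sim S (e # p)) x = sim_map (S e) (sim_map (path_sim S p) x)"
  by (simp add: sim_map_def matrix_vector_mul_assoc matrix_vector_right_distrib matrix_vector_mult_scaleR
      scaleR_right_distrib)

lemma sim_map_path_sim_append:
  "sim_map (path_sim S (p @ p')) x = sim_map (path_sim S p) (sim_map (path_sim S p') x)"
  by (induction p) (simp_all del: path_sim.simps)

lemma orthogonal_path_orth:
  assumes "\<And>e. e \<in> set p \<Longrightarrow> orthogonal_matrix (orth (S e))"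
  shows "orthogonal_matrix (path_orth S p)"
  using assms by (induction p) (simp_all add: orthogonal_matrix_id orthogonal_matrix_mul)

lemma sim_map_id [simp]: "sim_map \<lparr>ratio = 1, orth = mat 1, transl = 0\<rparr> = (\<lambda>x. x)"
  by (rule ext) (simp add: sim_map_def)

lemma dist_sim_map:
  assumes "orthogonal_matrix (orth A)" "0 \<le> ratio A"
  shows "dist (sim_map A x) (sim_map A y) = ratio A * dist x y"
proof -
  have "orthogonal_transformation ((*v) (orth A))" 
    using assms(1) by (simp add: orthogonal_transformation_matrix)
  then have "norm (orth A *v (x - y)) = norm (x - y)" by (simp add: orthogonal_transformation)
  then show ?thesis using assms(2)
    by (simp add: sim_map_def dist_norm scaleR_diff_right[symmetric] matrix_vector_mult_diff_distrib[symmetric])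
qed

lemma contracting_similarity_comp:
  assumes "p \<noteq> []" "\<And>e. e \<in> set p \<Longrightarrow> contracting_similarity (S e)"
  shows "contracting_similarity (path_sim S p)"
proof -
  have "0 < ratio (path_sim S p) \<and> ratio (path_sim S p) \<le> 1 \<and> (p \<noteq> [] \<longrightarrow> ratio (path_sim S p) < 1)"
    using assms(2)
  proof (induction p)
    case (Cons e p)
    then have e: "0 < ratio (S e)" "ratio (S e) < 1" and IH: "0 < ratio (path_sim S p)" "ratio (path_sim S p) \<le> 1"
      by (auto simp: contracting_similarity_def)
    have "ratio (S e) * ratio (path_sim S p) \<le> ratio (S e) * 1" using e IH by (intro mult_left_mono) auto
    also have "\<dots> < 1" using e by simp
    finally show ?case using e IH by simp
  qed simp
  then show ?thesis using assms orthogonal_path_orth[of p S] by (simp add: contracting_similarity_def)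
qed

section \<open>Counting paths and their linear parts\<close>

lemma exponential_beats_polynomial:
  fixes b c :: real
  assumes b: "0 < b" "b < 1" and u: "0 < u" and c: "0 < c"
  shows "\<forall>\<^sub>F n in sequentially. real ((n + l) ^ N) * (b ^ n) powr u \<le> c"
proof -
  define B where "B = b powr u"
  have B: "0 < B" "B < 1" using b u powr_less_mono2[of u b 1] by (auto simp: B_def)
  have eq: "(b ^ n) powr u = B ^ n" for n using b 
    by (simp add: B_def powr_realpow[symmetric] powr_powr mult.commute)
  define a where "a = - ln B"
  have a: "a > 0" and Ba: "B = exp (- a)" using B by (auto simp: a_def)
  have "((\<lambda>n::nat. (real n + real l) powr real N * exp (- a * real n)) \<longlongrightarrow> 0) sequentially"
    using a by real_asymp
  then have "\<forall>\<^sub>F n in sequentially. (real n + real l) powr real N * exp (- a * real n) < c"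
    using c by (rule order_tendstoD)
  then show ?thesis using eventually_gt_at_top[of 0]
  proof eventually_elim
    case (elim n)
    then have "(real n + real l) powr real N = real ((n + l) ^ N)" by (simp add: powr_realpow)
    moreover have "exp (- a * real n) = B ^ n" using Ba by (simp add: exp_of_nat_mult mult.commute flip: exp_of_nat_mult)
    ultimately show ?case using elim eq by simp
  qed
qed

lemma sum_powers_le: "(\<Sum>i\<le>n. (E::nat) ^ i) \<le> (E + 1) ^ n"
proof (induction n)
  case (Suc n)
  have "(\<Sum>i\<le>Suc n. E ^ i) = (\<Sum>i\<le>n. E ^ i) + E * E ^ n" by simp
  also have "\<dots> \<le> (E + 1) ^ n + E * (E + 1) ^ n" by (intro add_mono Suc.IH mult_le_mono power_mono) auto
  finally show ?case by simp
qed simp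

text \<open>
  Products in which each factor from \<open>Z\<close> occurs at most \<open>n\<close> times.
\<close>

definition bounded_products :: "complex set \<Rightarrow> nat \<Rightarrow> complex set" where
  "bounded_products Z n = (\<lambda>k. \<Prod>a\<in>Z. a ^ k a) ` (Z \<rightarrow>\<^sub>E {..n})"

lemma card_bounded_products:
  assumes "finite Z"
  shows "finite (bounded_products Z n)" "card (bounded_products Z n) \<le> (n + 1) ^ card Z"
proof -
  have f: "finite (Z \<rightarrow>\<^sub>E {..n})" using assms by (intro finite_PiE) auto
  then show "finite (bounded_products Z n)" by (simp add: bounded_products_def)
  have "card (bounded_products Z n) \<le> card (Z \<rightarrow>\<^sub>E {..n})"
    unfolding bounded_products_def by (rule card_image_le[OF f])
  also have "\<dots> = (n + 1) ^ card Z" using assms by (simp add: card_PiE)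
  finally show "card (bounded_products Z n) \<le> (n + 1) ^ card Z" .
qed

lemma bounded_products_mono: "m \<le> n \<Longrightarrow> bounded_products Z m \<subseteq> bounded_products Z n"
  unfolding bounded_products_def by (intro image_mono PiE_mono) auto

lemma one_in_bounded_products: "1 \<in> bounded_products Z 0"
  unfolding bounded_products_def by (rule image_eqI[of _ _ "\<lambda>a\<in>Z. 0"]) auto

lemma mult_bounded_products:
  assumes "finite Z" "a \<in> Z" "x \<in> bounded_products Z n"
  shows "a * x \<in> bounded_products Z (Suc n)"
proof -
  obtain k where k: "k \<in> Z \<rightarrow>\<^sub>E {..n}" "x = (\<Prod>a\<in>Z. a ^ k a)"
    using assms(3) by (auto simp: bounded_products_def)
  have "(\<Prod>b\<in>Z. b ^ (k(a := Suc (k a))) b) = a ^ Suc (k a) * (\<Prod>b\<in>Z - {a}. b ^ k b)"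
    using assms by (subst prod.remove[of Z a]) (auto intro!: prod.cong)
  also have "\<dots> = a * x" unfolding k(2) using prod.remove[OF assms(1,2), of "\<lambda>b. b ^ k b"] by simp
  finally have "a * x = (\<Prod>b\<in>Z. b ^ (k(a := Suc (k a))) b)" by simp
  moreover have "k(a := Suc (k a)) \<in> Z \<rightarrow>\<^sub>E {..Suc n}"
    using k(1) assms(2) by (auto simp: PiE_iff extensional_def le_Suc_eq)
  ultimately show ?thesis unfolding bounded_products_def by blast
qed

definition conj_closure :: "complex set \<Rightarrow> complex set" where
  "conj_closure Z = Z \<union> cnj ` Z"

text \<open>
  Conjugation of a factor stays inside the finite set \<open>Z\<close>, so the code of a path of length \<open>k\<close> is a
  product of \<open>k\<close> elements of \<open>Z\<close>.  The weights \<open>w\<close> are the ratios when linear parts are counted, and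
  constantly \<open>1\<close> when only the orthogonal parts matter.
\<close>

lemma path_code_in_bounded_products:
  fixes S :: "'e \<Rightarrow> similarity" and w :: "'e \<Rightarrow> real"
  assumes E: "finite E" "set p \<subseteq> E" and orth: "\<And>e. e \<in> E \<Longrightarrow> orthogonal_matrix (orth (S e))"
  defines "Z \<equiv> conj_closure ((\<lambda>e. of_real (w e) * first_col (orth (S e))) ` E)"
  shows "of_real (prod_list (map w p)) * first_col (path_orth S p) \<in> bounded_products Z (length p)"
proof -
  define z where "z p = of_real (prod_list (map w p)) * first_col (path_orth S p)" for p
  have Z: "finite Z" using E by (simp add: Z_def conj_closure_def)
  have "z p \<in> bounded_products Z (length p) \<and> cnj (z p) \<in> bounded_products Z (length p)"
    using E(2)
  proof (induction p)
    case Nil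
    then show ?case using one_in_bounded_products by (simp add: z_def)
  next
    case (Cons e p)
    define a where "a = of_real (w e) * first_col (orth (S e))"
    have "a \<in> (\<lambda>e. of_real (w e) * first_col (orth (S e))) ` E" using Cons.prems by (auto simp: a_def)
    then have a: "a \<in> Z" "cnj a \<in> Z" unfolding Z_def conj_closure_def by blast+
    have "z (e # p) = a * z p \<or> z (e # p) = a * cnj (z p)"
      using Cons.prems orth[of e] by (auto simp: z_def a_def first_col_mult)
    then show ?case using Cons a by (auto intro!: mult_bounded_products[OF Z])
  qed
  then show ?thesis by (simp add: z_def)
qed

section \<open>Graph directed systems\<close>

locale gd_system =
  fixes G :: "(nat, 'e) pre_digraph" and q :: nat and S :: "'e \<Rightarrow> similarity"
    and K :: "nat \<Rightarrow> (real^2) set" and j :: nat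
  assumes gd: "gd_ifs G q S" and sc: "strongly_connected G" and att: "gd_attractor G S K"
    and j: "j \<in> {1..q}"
begin

sublocale fin_digraph G using gd by (simp add: gd_ifs_def)

lemma j_in_verts: "j \<in> verts G" using gd j by (simp add: gd_ifs_def)

lemma arc_contracting: "e \<in> arcs G \<Longrightarrow> contracting_similarity (S e)"
  using gd by (simp add: gd_ifs_def)

lemma orth_arc: "e \<in> arcs G \<Longrightarrow> orthogonal_matrix (orth (S e))"
  using arc_contracting by (simp add: contracting_similarity_def)

lemma path_contracting: "awalk i p k \<Longrightarrow> p \<noteq> [] \<Longrightarrow> contracting_similarity (path_sim S p)"
  by (rule contracting_similarity_comp) (auto simp: awalk_def arc_contracting)

lemma orth_path: "awalk i p k \<Longrightarrow> orthogonal_matrix (path_orth S p)"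
  by (rule orthogonal_path_orth) (auto simp: awalk_def orth_arc)

lemma ratio_path_pos: "awalk i p k \<Longrightarrow> 0 < ratio (path_sim S p)"
  using path_contracting[of i p k] by (cases "p = []") (auto simp: contracting_similarity_def)

lemma dist_path: "awalk i p k \<Longrightarrow>
    dist (sim_map (path_sim S p) x) (sim_map (path_sim S p) y) = ratio (path_sim S p) * dist x y"
  using orth_path[of i p k] ratio_path_pos[of i p k] by (intro dist_sim_map) auto

lemma reach:
  assumes "i \<in> verts G" "k \<in> verts G"
  shows "\<exists>p. awalk i p k"
  using sc assms reachable_awalk by (auto simp: strongly_connected_def)

lemma cycle_exists: "\<exists>p. p \<noteq> [] \<and> awalk j p j"
proof -
  obtain e where e: "e \<in> arcs G" "tail G e = j" using gd j_in_verts unfolding gd_ifs_def by blast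
  obtain p where "awalk (head G e) p j" using reach[OF head_in_verts[OF e(1)] j_in_verts] by blast
  then have "awalk j (e # p) j" using e by (simp add: awalk_Cons_iff)
  then show ?thesis by blast
qed

section \<open>Prescribing the rotation of a cycle\<close>

abbreviation cycle_orths where "cycle_orths \<equiv> path_orth S ` cycles_at G j"

lemma cycle_orths_mult: "A \<in> cycle_orths \<Longrightarrow> B \<in> cycle_orths \<Longrightarrow> A ** B \<in> cycle_orths"
proof -
  assume "A \<in> cycle_orths" "B \<in> cycle_orths"
  then obtain p p' where "p \<noteq> []" "awalk j p j" "A = path_orth S p" "awalk j p' j" "B = path_orth S p'"
    by (auto simp: cycles_at_def)
  then have "p @ p' \<in> cycles_at G j" "A ** B = path_orth S (p @ p')"
    by (auto simp: cycles_at_def path_orth_append intro: awalk_appendI)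
  then show ?thesis by blast
qed

lemma cycle_orths_E:
  assumes "A \<in> cycle_orths"
  obtains p where "p \<noteq> []" "awalk j p j" "A = path_orth S p"
  using assms unfolding cycles_at_def by (elim imageE CollectE conjE)

lemma cycle_orths_I: "p \<noteq> [] \<Longrightarrow> awalk j p j \<Longrightarrow> path_orth S p \<in> cycle_orths"
  unfolding cycles_at_def by (intro imageI CollectI conjI)

lemma cycle_orths_orth: "A \<in> cycle_orths \<Longrightarrow> orthogonal_matrix A"
  by (elim cycle_orths_E) (simp add: orth_path)

lemma cycle_orths_nonempty: "cycle_orths \<noteq> {}"
proof -
  obtain p where "p \<noteq> []" "awalk j p j" using cycle_exists by blast
  from cycle_orths_I[OF this] show ?thesis by fast
qed

lemma cycle_orths_sub: "cycle_orths \<subseteq> gd_group G S j"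
  unfolding gd_group_def by (intro subsetI generate.incl)

definition dense_generator :: "real^2^2 \<Rightarrow> bool" where
  "dense_generator Q \<longleftrightarrow> Q \<in> gd_group G S j \<inter> SO2 \<and> gd_group G S j \<inter> SO2 \<subseteq> closure (generate O2 {Q})"

lemma dense_generator_if_infinite_order:
  assumes Q: "Q \<in> cycle_orths \<inter> SO2" and inf: "\<And>k. k > 0 \<Longrightarrow> first_col Q ^ k \<noteq> 1"
  shows "dense_generator Q"
  unfolding dense_generator_def
proof (intro conjI subsetI)
  show "Q \<in> gd_group G S j \<inter> SO2" using Q cycle_orths_sub by blast
  fix A assume "A \<in> gd_group G S j \<inter> SO2"
  then have A: "A \<in> SO2" by simp
  have "first_col A \<in> closure (range (\<lambda>k. first_col Q ^ k))"
    using Q A inf norm_first_col by (intro powers_dense_in_circle) (auto simp: SO2_iff)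
  then have "rot (first_col A) \<in> rot ` closure (range (\<lambda>k. first_col Q ^ k))" by blast
  also have "\<dots> \<subseteq> closure (generate O2 {Q})"
    by (rule image_closure_subset)
      (use Q rot_power_in_generate closure_subset in \<open>auto intro: continuous_on_subset[OF continuous_rot]\<close>)
  finally show "A \<in> closure (generate O2 {Q})" using rot_first_col[OF A] by simp
qed

text \<open>
  The rotations of cycles lie in the group generated by the finitely many codes of edges and their
  conjugates, so torsion bounds their exponent and there are finitely many of them.
\<close>

lemma torsion_rotations_cyclic:
  assumes tors: "\<And>B. B \<in> cycle_orths \<inter> SO2 \<Longrightarrow> \<exists>k>0. first_col B ^ k = 1"
  obtains Q where "Q \<in> cycle_orths \<inter> SO2" "finite (cycle_orths \<inter> SO2)" "cycle_orths \<inter> SO2 = range (\<lambda>k. rot (first_col Q ^ k))"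
proof -
  \<comment> \<open>generators of an abelian group that contains all rotations of cycles\<close>
  define Z where "Z = conj_closure ((\<lambda>e. first_col (orth (S e))) ` arcs G)"
  have Z: "finite Z" "0 \<notin> Z"
    using norm_first_col orth_arc by (auto simp: Z_def conj_closure_def) (metis norm_zero zero_neq_one)+
  obtain D where D: "D > 0" and DZ: "\<And>n N. N > 0 \<Longrightarrow> (\<Prod>a\<in>Z. a powi n a) ^ N = 1 \<Longrightarrow> (\<Prod>a\<in>Z. a powi n a) ^ (D::nat) = 1"
    using torsion_exponent[OF Z] by blast
  have pD: "first_col B ^ D = 1" if B: "B \<in> cycle_orths \<inter> SO2" for B
  proof -
    obtain p where p: "awalk j p j" "B = path_orth S p" using B by (auto simp: cycles_at_def)
    have "of_real (prod_list (map (\<lambda>_. 1) p)) * first_col (path_orth S p) \<in> bounded_products Z (length p)"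
      unfolding Z_def
      using path_code_in_bounded_products[of "arcs G" p S "\<lambda>_. 1"] p orth_arc by (auto simp: awalk_def)
    moreover have "prod_list (map (\<lambda>_. 1) p) = (1::real)" by (induction p) auto
    ultimately have "first_col B \<in> bounded_products Z (length p)" using p by simp
    then obtain k where "first_col B = (\<Prod>a\<in>Z. a powi int (k a))" by (auto simp: bounded_products_def)
    then show ?thesis using DZ tors[OF B] by metis
  qed
  define H where "H = first_col ` (cycle_orths \<inter> SO2)"
  have "H \<subseteq> {z. z ^ D = 1}" using pD by (auto simp: H_def)
  then have "finite H" using finite_roots_unity[of D] D finite_subset by auto
  obtain A where A: "A \<in> cycle_orths" using cycle_orths_nonempty by blast
  have "det A = 1 \<or> det A = -1" using A cycle_orths_orth det_orthogonal_matrix by blast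
  then have "A ** A \<in> cycle_orths \<inter> SO2" using A cycle_orths_mult cycle_orths_orth[OF cycle_orths_mult[OF A A]] by (auto simp: SO2_iff det_mul)
  then have "H \<noteq> {}" by (auto simp: H_def)
  have "norm x = 1" if "x \<in> H" for x using that cycle_orths_orth norm_first_col by (auto simp: H_def)
  then have "0 \<notin> H" by force
  have Hm: "x * y \<in> H" if xy: "x \<in> H" "y \<in> H" for x y
  proof -
    obtain A B where AB: "A \<in> cycle_orths \<inter> SO2" "B \<in> cycle_orths \<inter> SO2" "x = first_col A" "y = first_col B" using xy by (auto simp: H_def)
    then have "A ** B \<in> cycle_orths \<inter> SO2" "x * y = first_col (A ** B)"
      using cycle_orths_mult cycle_orths_orth[OF cycle_orths_mult[of A B]] by (auto simp: SO2_iff det_mul first_col_mult)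
    then show ?thesis by (simp add: H_def)
  qed
  obtain g where g: "g \<in> H" "H = range (\<lambda>k::nat. g ^ k)"
    using finite_circle_submonoid_cyclic[OF \<open>finite H\<close> \<open>H \<noteq> {}\<close> \<open>0 \<notin> H\<close> Hm] by blast
  from g(1) obtain Q where Q: "Q \<in> cycle_orths \<inter> SO2" "g = first_col Q" unfolding H_def by blast
  have "cycle_orths \<inter> SO2 = rot ` H" unfolding H_def image_image by (simp add: rot_first_col cong: image_cong_simp)
  then show ?thesis using that[of Q] Q g \<open>finite H\<close> by (metis finite_imageI image_image)
qed

text \<open>
  Since the square of the orthogonal part of a cycle is a rotation of finite order, these orthogonal
  parts are closed under inverses.  They therefore exhaust the transformation group, whose rotations
  are then the powers of \<open>Q\<close>.
\<close>

lemma dense_generator_if_torsion: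
  assumes Q: "Q \<in> cycle_orths \<inter> SO2" and fin: "finite (cycle_orths \<inter> SO2)" and cyc: "cycle_orths \<inter> SO2 = range (\<lambda>k. rot (first_col Q ^ k))"
  shows "dense_generator Q" and "\<And>A. A \<in> cycle_orths \<Longrightarrow> \<exists>B\<in>cycle_orths. A ** B = mat 1"
proof -
  have one: "mat 1 \<in> cycle_orths \<inter> SO2" unfolding cyc by (rule range_eqI[of _ _ 0]) (simp add: rot_one)
  show inv: "\<exists>B\<in>cycle_orths. A ** B = mat 1" if A: "A \<in> cycle_orths" for A
  proof -
    have "det A = 1 \<or> det A = -1" using A cycle_orths_orth det_orthogonal_matrix by blast
    then have AA: "A ** A \<in> cycle_orths \<inter> SO2" using A cycle_orths_mult cycle_orths_orth[OF cycle_orths_mult[OF A A]] by (auto simp: SO2_iff det_mul)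
    have pw: "rot (first_col Q ^ k) \<in> cycle_orths \<inter> SO2" for k unfolding cyc by blast
    have "\<not> inj (\<lambda>k. rot (first_col Q ^ k))" using fin cyc by (metis finite_imageD infinite_UNIV_nat)
    then obtain k l where kl: "k < l" "rot (first_col Q ^ k) = rot (first_col Q ^ l)" by (metis linorder_injI)
    then have "first_col Q ^ k = first_col Q ^ (k + (l - k))" by (metis first_col_rot le_add_diff_inverse less_imp_le)
    also have "\<dots> = first_col Q ^ k * first_col Q ^ (l - k)" by (rule power_add)
    finally have "first_col Q ^ k = first_col Q ^ k * first_col Q ^ (l - k)" .
    moreover have "first_col Q \<noteq> 0" using Q norm_first_col by (metis IntE SO2_iff norm_zero zero_neq_one)
    ultimately have "first_col Q ^ (l - k) = 1" by simp
    then have "\<exists>D>0. first_col Q ^ D = 1" using kl(1) by (intro exI[of _ "l - k"]) simp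
    then obtain D where D: "D > 0" "first_col Q ^ D = 1" by blast
    obtain k where k: "A ** A = rot (first_col Q ^ k)" using AA cyc by auto
    \<comment> \<open>the inverse of \<open>A ** A\<close>, as the exponents add up to the multiple \<open>D * k\<close> of \<open>D\<close>\<close>
    define C where "C = rot (first_col Q ^ ((D - 1) * k))"
    have "A ** A ** C = rot (first_col Q ^ (k + (D - 1) * k))" by (simp add: k C_def rot_mult power_add)
    also have "k + (D - 1) * k = D * k" using D by (cases D) auto
    also have "rot (first_col Q ^ (D * k)) = mat 1" using D by (simp add: power_mult rot_one)
    finally have "A ** (A ** C) = mat 1" by (simp add: matrix_mul_assoc)
    moreover have "A ** C \<in> cycle_orths" using pw A unfolding C_def by (intro cycle_orths_mult) auto
    ultimately show ?thesis by blast
  qed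
  interpret O2: group O2 by (rule group_O2)
  have gen: "A \<in> cycle_orths" if "A \<in> generate O2 cycle_orths" for A
    using that
  proof (induction rule: generate.induct)
    case one then show ?case using \<open>mat 1 \<in> cycle_orths \<inter> SO2\<close> by (simp add: O2_def)
  next
    case (inv h)
    then obtain B where B: "B \<in> cycle_orths" "h ** B = mat 1" using \<open>\<And>A. A \<in> cycle_orths \<Longrightarrow> \<exists>B\<in>cycle_orths. A ** B = mat 1\<close> by blast
    then have "B ** h = mat 1" using matrix_left_right_inverse by blast
    then have "inv\<^bsub>O2\<^esub> h = B" using B inv cycle_orths_orth by (intro O2.inv_equality) (auto simp: O2_def)
    then show ?case using B by simp
  next
    case (eng A B) then show ?case using cycle_orths_mult by (simp add: O2_def)
  qed
  show "dense_generator Q" unfolding dense_generator_def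
  proof (intro conjI subsetI)
    show "Q \<in> gd_group G S j \<inter> SO2" using Q cycle_orths_sub by blast
    fix A assume "A \<in> gd_group G S j \<inter> SO2"
    then have "A \<in> cycle_orths \<inter> SO2" using gen by (auto simp: gd_group_def)
    then obtain k where "A = rot (first_col Q ^ k)" using cyc by auto
    then have "A \<in> generate O2 {Q}" using rot_power_in_generate Q by auto
    then show "A \<in> closure (generate O2 {Q})" using closure_subset by blast
  qed
qed

text \<open>
  If \<open>B\<close> has infinite order and \<open>T\<close> has finite order, then \<open>T ** B\<close> has infinite order, because rotations
  commute.  In the torsion case one completing cycle is chosen for each of the finitely many rotations.
\<close>

lemma dense_generator_extension_rotation:
  "\<exists>C. finite C \<and> (\<forall>c\<in>C. awalk j c j) \<and> (\<forall>T\<in>cycle_orths \<inter> SO2. \<exists>c\<in>C. dense_generator (T ** path_orth S c))"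
proof (cases "\<exists>B\<in>cycle_orths \<inter> SO2. \<forall>k>0. first_col B ^ k \<noteq> 1")
  case True
  then obtain B where B: "B \<in> cycle_orths \<inter> SO2" "\<And>k. k > 0 \<Longrightarrow> first_col B ^ k \<noteq> 1" by blast
  then obtain b where b: "awalk j b j" "B = path_orth S b" by (auto simp: cycles_at_def)
  show ?thesis
  proof (intro exI[of _ "{[], b}"] conjI ballI)
    fix T assume T: "T \<in> cycle_orths \<inter> SO2"
    show "\<exists>c\<in>{[], b}. dense_generator (T ** path_orth S c)"
    proof (cases "\<exists>l>0. first_col T ^ l = 1")
      case False
      then have "dense_generator T" using dense_generator_if_infinite_order[OF T] by blast
      then show ?thesis by simp
    next
      case True
      then obtain l where l: "l > 0" "first_col T ^ l = 1" by blast
      have "T ** B \<in> cycle_orths" using T B cycle_orths_mult by auto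
      then have TB: "T ** B \<in> cycle_orths \<inter> SO2" using T B cycle_orths_orth by (auto simp: SO2_iff det_mul)
      have "first_col (T ** B) ^ k \<noteq> 1" if k: "k > 0" for k
      proof
        assume "first_col (T ** B) ^ k = 1"
        then have "(first_col T * first_col B) ^ k = 1" using T by (simp add: first_col_mult_SO2)
        then have "((first_col T * first_col B) ^ k) ^ l = 1" by simp
        then have "(first_col T ^ l) ^ k * first_col B ^ (k * l) = 1"
          by (simp add: power_mult_distrib power_mult[symmetric] mult.commute[of l k])
        then have "first_col B ^ (k * l) = 1" using l by simp
        then show False using B(2)[of "k * l"] k l by simp
      qed
      then have "dense_generator (T ** B)" by (rule dense_generator_if_infinite_order[OF TB])
      then show ?thesis using b by simp
    qed
  qed (use b j_in_verts in \<open>auto simp: awalk_Nil_iff\<close>)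
next
  case False
  then have tors: "\<exists>k>0. first_col B ^ k = 1" if "B \<in> cycle_orths \<inter> SO2" for B using that by blast
  obtain Q where Q: "Q \<in> cycle_orths \<inter> SO2" "finite (cycle_orths \<inter> SO2)" "cycle_orths \<inter> SO2 = range (\<lambda>k. rot (first_col Q ^ k))"
    by (rule torsion_rotations_cyclic[OF tors])
  have "\<exists>c. awalk j c j \<and> T ** path_orth S c = Q" if T: "T \<in> cycle_orths \<inter> SO2" for T
  proof -
    obtain B where B: "B \<in> cycle_orths" "T ** B = mat 1" using dense_generator_if_torsion(2)[OF Q] T by blast
    have "B ** Q \<in> cycle_orths" using B Q cycle_orths_mult by blast
    then obtain c where "awalk j c j" "B ** Q = path_orth S c" by (rule cycle_orths_E)
    moreover have "T ** (B ** Q) = Q" using B by (simp add: matrix_mul_assoc)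
    ultimately show ?thesis by metis
  qed
  then have "\<forall>T\<in>cycle_orths \<inter> SO2. \<exists>c. awalk j c j \<and> T ** path_orth S c = Q" by blast
  from bchoice[OF this] obtain f where f: "\<forall>T\<in>cycle_orths \<inter> SO2. awalk j (f T) j \<and> T ** path_orth S (f T) = Q" ..
  show ?thesis
  proof (intro exI[of _ "f ` (cycle_orths \<inter> SO2)"] conjI ballI)
    show "finite (f ` (cycle_orths \<inter> SO2))" using Q(2) by (rule finite_imageI)
    show "awalk j c j" if "c \<in> f ` (cycle_orths \<inter> SO2)" for c using that f by (elim imageE) simp
    fix T assume T: "T \<in> cycle_orths \<inter> SO2"
    then have "dense_generator (T ** path_orth S (f T))" using f dense_generator_if_torsion(1)[OF Q] by simp
    then show "\<exists>c\<in>f ` (cycle_orths \<inter> SO2). dense_generator (T ** path_orth S c)" using T by (intro bexI[of _ "f T"] imageI)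
  qed
qed

text \<open>
  A reflection \<open>T\<close> is first turned into a rotation by a fixed cycle whose orthogonal part is a reflection.
\<close>

lemma dense_generator_extension:
  "\<exists>C. finite C \<and> (\<forall>c\<in>C. awalk j c j) \<and> (\<forall>T\<in>cycle_orths. \<exists>c\<in>C. dense_generator (T ** path_orth S c))"
proof -
  from dense_generator_extension_rotation obtain C where C: "finite C" "\<forall>c\<in>C. awalk j c j"
      "\<forall>T\<in>cycle_orths \<inter> SO2. \<exists>c\<in>C. dense_generator (T ** path_orth S c)"
    by (elim exE conjE)
  show ?thesis
  proof (cases "cycle_orths \<subseteq> SO2")
    case True
    then have "cycle_orths \<inter> SO2 = cycle_orths" by (rule Int_absorb2)
    then show ?thesis using C by (intro exI[of _ C]) simp
  next
    case False
    then obtain b where b: "b \<in> cycles_at G j" "path_orth S b \<notin> SO2" by auto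
    have refl: "det T = -1" if "T \<in> cycle_orths" "T \<notin> SO2" for T
      using that cycle_orths_orth[of T] det_orthogonal_matrix[of T] by (auto simp: SO2_iff)
    have bw: "awalk j b j" using b by (simp add: cycles_at_def)
    show ?thesis
    proof (intro exI[of _ "C \<union> (\<lambda>c. b @ c) ` C"] conjI ballI)
      fix T assume T: "T \<in> cycle_orths"
      show "\<exists>c\<in>C \<union> (\<lambda>c. b @ c) ` C. dense_generator (T ** path_orth S c)"
      proof (cases "T \<in> SO2")
        case True
        then show ?thesis using bspec[OF C(3), of T] T by blast
      next
        case False
        have "T ** path_orth S b \<in> cycle_orths" using T b(1) by (intro cycle_orths_mult) auto
        moreover have "det (T ** path_orth S b) = 1" using refl T False b by (auto simp: det_mul)
        ultimately have "T ** path_orth S b \<in> cycle_orths \<inter> SO2" using cycle_orths_orth by (auto simp: SO2_iff)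
        then obtain c where "c \<in> C" "dense_generator (T ** path_orth S b ** path_orth S c)"
          using bspec[OF C(3)] by blast
        then show ?thesis
          by (intro bexI[of _ "b @ c"]) (simp_all add: path_orth_append matrix_mul_assoc)
      qed
    next
      fix c assume "c \<in> C \<union> (\<lambda>c. b @ c) ` C"
      then show "awalk j c j" using C(2) bw awalk_appendI by blast
    qed (use C in simp)
  qed
qed

section \<open>Pieces of comparable size\<close>

lemma K_nonempty: "i \<in> verts G \<Longrightarrow> K i \<noteq> {}" 
  and K_compact: "i \<in> verts G \<Longrightarrow> compact (K i)"
  by (drule bspec[OF att[unfolded gd_attractor_def]], elim conjE, assumption)+

lemma K_eq:
  assumes "i \<in> verts G"
  shows "K i = (\<Union>k\<in>verts G. \<Union>e\<in>{e\<in>arcs G. tail G e = i \<and> head G e = k}. sim_map (S e) ` K k)"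
  using bspec[OF att[unfolded gd_attractor_def] assms] by (elim conjE)

lemma arc_image:
  assumes e: "e \<in> arcs G"
  shows "sim_map (S e) ` K (head G e) \<subseteq> K (tail G e)"
  unfolding K_eq[OF tail_in_verts[OF e]] using e head_in_verts[OF e] by fast

lemma K_arcE:
  assumes "i \<in> verts G" "x \<in> K i"
  obtains e y where "e \<in> arcs G" "tail G e = i" "y \<in> K (head G e)" "x = sim_map (S e) y"
  using assms(2) unfolding K_eq[OF assms(1)] by blast

lemma path_image: "awalk i p k \<Longrightarrow> sim_map (path_sim S p) ` K k \<subseteq> K i"
proof (induction p arbitrary: i)
  case Nil
  then show ?case by (simp add: awalk_Nil_iff del: path_sim.simps)
next
  case (Cons e p)
  then have e: "e \<in> arcs G" "tail G e = i" and p: "awalk (head G e) p k" by (simp_all add: awalk_Cons_iff)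
  have "sim_map (path_sim S (e # p)) ` K k = sim_map (S e) ` (sim_map (path_sim S p) ` K k)"
    unfolding image_image by (rule image_cong[OF refl sim_map_path_sim_Cons])
  also have "\<dots> \<subseteq> sim_map (S e) ` K (head G e)" by (rule image_mono[OF Cons.IH[OF p]])
  also have "\<dots> \<subseteq> K i" using arc_image[OF e(1)] e(2) by simp
  finally show ?case .
qed

lemma ratio_bounds: "\<exists>a b. 0 < a \<and> a < 1 \<and> 0 < b \<and> b < 1 \<and> (\<forall>e\<in>arcs G. a \<le> ratio (S e) \<and> ratio (S e) \<le> b)"
proof -
  define R where "R = (\<lambda>e. ratio (S e)) ` arcs G"
  have R: "finite R" "\<And>r. r \<in> R \<Longrightarrow> 0 < r \<and> r < 1" using arc_contracting by (auto simp: R_def contracting_similarity_def)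
  define a b where "a = Min (insert (1/2) R)" and "b = Max (insert (1/2) R)"
  have "0 < a" "b < 1" using R by (auto simp: a_def b_def)
  moreover have "a \<le> r" "r \<le> b" if "r \<in> insert (1/2) R" for r
    using that R(1) unfolding a_def b_def by (simp_all only: Min_le Max_ge finite_insert)
  moreover from this(1)[of "1/2"] this(2)[of "1/2"] have "a < 1" "0 < b" by simp_all
  ultimately show ?thesis unfolding R_def by (intro exI[of _ a] exI[of _ b]) auto
qed

lemma K_diam_bound: "\<exists>D>0. \<forall>i\<in>verts G. \<forall>x\<in>K i. \<forall>y\<in>K i. dist x y \<le> D"
proof -
  have "bounded (\<Union>i\<in>verts G. K i)" using K_compact compact_imp_bounded by (intro bounded_UN) auto
  then obtain D where D: "\<forall>x\<in>(\<Union>i\<in>verts G. K i). \<forall>y\<in>(\<Union>i\<in>verts G. K i). dist x y \<le> D"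
    using bounded_two_points by blast
  show ?thesis
    by (intro exI[of _ "max D 1"]) (use D in \<open>auto simp: le_max_iff_disj\<close>)
qed

text \<open>
  Every point lies in a piece of prescribed size.  The induction removes the first edge \<open>e\<close>, which
  divides the required size \<open>\<tau>\<close> by \<open>ratio (S e)\<close>; the empty path works as soon as \<open>\<tau> \<ge> 1\<close>.
\<close>

lemma cut_path:
  assumes ab: "0 < a" "a < 1" "0 < b" "b < 1" "\<forall>e\<in>arcs G. a \<le> ratio (S e) \<and> ratio (S e) \<le> b"
    and "i \<in> verts G" "x \<in> K i" "b ^ n \<le> \<tau>" "a * \<tau> \<le> 1"
  shows "\<exists>p k. awalk i p k \<and> x \<in> sim_map (path_sim S p) ` K k \<and> length p \<le> n \<and>
    a * \<tau> \<le> ratio (path_sim S p) \<and> ratio (path_sim S p) \<le> \<tau>"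
  using assms(6-9)
proof (induction n arbitrary: i x \<tau>)
  case 0
  then show ?case by (intro exI[of _ "[]"] exI[of _ i]) (simp_all add: awalk_Nil_iff)
next
  case (Suc n)
  show ?case
  proof (cases "1 \<le> \<tau>")
    case True
    then show ?thesis using Suc.prems by (intro exI[of _ "[]"] exI[of _ i]) (simp_all add: awalk_Nil_iff)
  next
    case False
    obtain e y where e: "e \<in> arcs G" "tail G e = i" "y \<in> K (head G e)" "x = sim_map (S e) y"
      using Suc.prems(1,2) by (rule K_arcE)
    have r: "a \<le> ratio (S e)" "ratio (S e) \<le> b" "0 < ratio (S e)" using ab e(1) by force+
    have \<tau>: "0 < \<tau>" using Suc.prems(3) ab(3) by (meson less_le_trans zero_less_power)
    have "b ^ n * ratio (S e) \<le> b ^ n * b" using r ab by (intro mult_left_mono) auto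
    also have "\<dots> \<le> \<tau>" using Suc.prems(3) by (simp add: mult.commute)
    finally have 1: "b ^ n \<le> \<tau> / ratio (S e)" using r by (simp add: field_simps)
    have "a * \<tau> \<le> ratio (S e) * 1" using r False ab \<tau> by (intro mult_mono) auto
    then have 2: "a * (\<tau> / ratio (S e)) \<le> 1" using r by (simp add: field_simps)
    obtain p k where p: "awalk (head G e) p k" "y \<in> sim_map (path_sim S p) ` K k" "length p \<le> n"
        "a * (\<tau> / ratio (S e)) \<le> ratio (path_sim S p)" "ratio (path_sim S p) \<le> \<tau> / ratio (S e)"
      using Suc.IH[OF head_in_verts[OF e(1)] e(3) 1 2] by (elim exE conjE)
    show ?thesis
    proof (intro exI[of _ "e # p"] exI[of _ k] conjI)
      show "awalk i (e # p) k" using e p(1) by (simp add: awalk_Cons_iff)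
      obtain z where z: "z \<in> K k" "y = sim_map (path_sim S p) z" using p(2) by (elim imageE)
      have "x = sim_map (path_sim S (e # p)) z" unfolding sim_map_path_sim_Cons e(4) z(2) ..
      then show "x \<in> sim_map (path_sim S (e # p)) ` K k" using z(1) by (rule image_eqI)
      show "length (e # p) \<le> Suc n" using p(3) by simp
      show "a * \<tau> \<le> ratio (path_sim S (e # p))" "ratio (path_sim S (e # p)) \<le> \<tau>"
        using p(4,5) r by (simp_all add: field_simps)
    qed
  qed
qed

definition cut_set :: "real \<Rightarrow> real \<Rightarrow> nat \<Rightarrow> 'e list set" where
  "cut_set a b n = {p. awalk j p (awlast j p) \<and> length p \<le> n \<and>
     a * b ^ n \<le> ratio (path_sim S p) \<and> ratio (path_sim S p) \<le> b ^ n}"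

text \<open>
  The endpoint is recovered from the path, so that pieces are indexed by paths alone.
\<close>

definition piece :: "'e list \<Rightarrow> (real^2) set" where
  "piece p = sim_map (path_sim S p) ` K (awlast j p)"

lemma cut_set_walk: "p \<in> cut_set a b n \<Longrightarrow> awalk j p (awlast j p)"
  by (simp add: cut_set_def)

lemma cut_set_finite: "finite (cut_set a b n)" and cut_set_card: "card (cut_set a b n) \<le> (card (arcs G) + 1) ^ n"
proof -
  have sub: "cut_set a b n \<subseteq> {p. set p \<subseteq> arcs G \<and> length p \<le> n}"
    unfolding cut_set_def awalk_def by blast
  show "finite (cut_set a b n)" by (rule finite_subset[OF sub]) (simp add: finite_lists_length_le)
  have "card (cut_set a b n) \<le> card {p. set p \<subseteq> arcs G \<and> length p \<le> n}"
    by (rule card_mono[OF _ sub]) (simp add: finite_lists_length_le)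
  also have "\<dots> = (\<Sum>i\<le>n. card (arcs G) ^ i)" by (simp add: card_lists_length_le)
  also have "\<dots> \<le> (card (arcs G) + 1) ^ n" by (rule sum_powers_le)
  finally show "card (cut_set a b n) \<le> (card (arcs G) + 1) ^ n" .
qed

lemma cut_set_cover:
  assumes ab: "0 < a" "a < 1" "0 < b" "b < 1" "\<forall>e\<in>arcs G. a \<le> ratio (S e) \<and> ratio (S e) \<le> b"
  shows "K j \<subseteq> (\<Union>p\<in>cut_set a b n. piece p)"
proof
  fix x assume x: "x \<in> K j"
  have "b ^ n \<le> 1" using ab by (simp add: power_le_one)
  then have le1: "a * b ^ n \<le> 1" using ab by (intro mult_le_one) auto
  obtain p k where p: "awalk j p k" "x \<in> sim_map (path_sim S p) ` K k" "length p \<le> n"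
    "a * b ^ n \<le> ratio (path_sim S p)" "ratio (path_sim S p) \<le> b ^ n"
    using cut_path[OF ab j_in_verts x order_refl le1] by (elim exE conjE)
  have k: "awlast j p = k" using p(1) by (rule awlast_of_awalk) simp
  then show "x \<in> (\<Union>p\<in>cut_set a b n. piece p)" using p by (intro UN_I[of p]) (simp_all add: cut_set_def piece_def)
qed

lemma piece_diam:
  assumes D: "\<forall>i\<in>verts G. \<forall>x\<in>K i. \<forall>y\<in>K i. dist x y \<le> D" and p: "p \<in> cut_set a b n" 
    and xy: "x \<in> piece p" "y \<in> piece p" and b: "0 < b"
  shows "dist x y \<le> D * b ^ n"
proof -
  have w: "awalk j p (awlast j p)" using p by (rule cut_set_walk)
  obtain x' y' where x': "x' \<in> K (awlast j p)" "y' \<in> K (awlast j p)" 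
    "x = sim_map (path_sim S p) x'" "y = sim_map (path_sim S p) y'" using xy by (auto simp: piece_def)
  have v: "awlast j p \<in> verts G" using w by (rule awalk_last_in_verts)
  then have D': "dist x' y' \<le> D" using D x'(1,2) by blast
  have "dist x y = ratio (path_sim S p) * dist x' y'" using dist_path[OF w] x' by simp
  also have "\<dots> \<le> b ^ n * D" using p D' b by (intro mult_mono) (auto simp: cut_set_def)
  finally show ?thesis by (simp add: mult.commute)
qed

text \<open>
  There are at most exponentially many pieces of size \<open>b ^ n\<close>.  Dimensions are extended reals, and an
  approximation of \<open>K j\<close> from inside up to \<open>\<epsilon>\<close> makes sense only if its dimension is finite.
\<close>

lemma dim_K_finite: "\<exists>d. hausdorff_dim (K j) \<le> ereal d"
proof -
  obtain a b where ab: "0 < a" "a < 1" "0 < b" "b < 1" "\<forall>e\<in>arcs G. a \<le> ratio (S e) \<and> ratio (S e) \<le> b"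
    using ratio_bounds by (elim exE conjE)
  obtain D where D: "D > 0" "\<forall>i\<in>verts G. \<forall>x\<in>K i. \<forall>y\<in>K i. dist x y \<le> D" using K_diam_bound by (elim exE conjE)
  define E where "E = real (card (arcs G) + 1)"
  have E: "E \<ge> 1" by (simp add: E_def)
  \<comment> \<open>each step multiplies the number of pieces by at most \<open>E\<close> and their weight by \<open>b powr s\<close>, and \<open>E * b powr s = 1 / 2\<close>\<close>
  define s where "s = log b (1 / (2 * E))"
  have bs: "b powr s = 1 / (2 * E)" using ab E by (simp add: s_def)
  have s: "s > 0"
  proof (rule ccontr)
    assume "\<not> s > 0"
    then have "b powr 0 \<le> b powr s" using ab by (intro powr_mono') auto
    then show False using bs E ab by simp
  qed
  have "hausdorff_dim (K j) \<le> ereal s"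
  proof (rule dim_le_if_small_covers[OF s])
    fix \<delta> e :: real assume \<delta>: "0 < \<delta>" and e: "0 < e"
    have "(\<lambda>n. D * b ^ n) \<longlonglongrightarrow> D * 0" using ab by (intro tendsto_intros LIMSEQ_power_zero) auto
    then have ev1: "\<forall>\<^sub>F n in sequentially. D * b ^ n < \<delta>" using \<delta> by (intro order_tendstoD) auto
    have "(\<lambda>n. D powr s * (1/2) ^ n) \<longlonglongrightarrow> D powr s * 0" by (intro tendsto_intros LIMSEQ_power_zero) auto
    then have ev2: "\<forall>\<^sub>F n in sequentially. D powr s * (1/2) ^ n < e" using e by (intro order_tendstoD) auto
    obtain n where n: "D * b ^ n < \<delta>" "D powr s * (1/2) ^ n < e"
      using eventually_happens[OF eventually_conj[OF ev1 ev2]] by auto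
    have "hausdorff_premeasure s \<delta> (K j) \<le> ennreal (real (card (cut_set a b n)) * (D * b ^ n) powr s)"
      using D ab n s piece_diam[OF D(2)]
      by (intro premeasure_le_card[OF cut_set_finite cut_set_cover[OF ab]]) auto
    also have "\<dots> \<le> ennreal e"
    proof (rule ennreal_leI)
      have "real (card (cut_set a b n)) \<le> E ^ n"
        unfolding E_def using cut_set_card[of a b n] by (metis of_nat_le_iff of_nat_power)
      then have "real (card (cut_set a b n)) * (D * b ^ n) powr s \<le> E ^ n * (D * b ^ n) powr s"
        by (intro mult_right_mono) auto
      also have "\<dots> = E ^ n * (D powr s * (b powr s) ^ n)"
        using D ab by (simp add: powr_mult powr_realpow[symmetric] powr_powr mult.commute)
      also have "\<dots> = D powr s * (E * b powr s) ^ n" by (simp add: power_mult_distrib)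
      also have "E * b powr s = 1 / 2" using bs E by simp
      finally show "real (card (cut_set a b n)) * (D * b ^ n) powr s \<le> e" using n by simp
    qed
    finally show "hausdorff_premeasure s \<delta> (K j) \<le> ennreal e" .
  qed
  then show ?thesis by blast
qed

section \<open>Many cycles with the same linear part\<close>

lemma ratio_path_sim: "ratio (path_sim S p) = prod_list (map (\<lambda>e. ratio (S e)) p)"
  by (induction p) simp_all

text \<open>
  The ratio and the first column of a path combine to one complex number, whose norm is the ratio.
  It lies in a set of polynomial size, and together with the determinant it determines the linear part.
\<close>

lemma few_linear_parts:
  "\<exists>N. \<forall>I n. finite I \<and> (\<forall>p\<in>I. awalk j p j \<and> length p \<le> n) \<longrightarrow>
    (\<exists>J\<subseteq>I. \<exists>\<rho> T. (\<forall>p\<in>J. ratio (path_sim S p) = \<rho> \<and> path_orth S p = T) \<and> card I \<le> card J * (2 * (n + 1) ^ N))"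
proof -
  define Z where "Z = conj_closure ((\<lambda>e. of_real (ratio (S e)) * first_col (orth (S e))) ` arcs G)"
  have Z: "finite Z" by (simp add: Z_def conj_closure_def)
  show ?thesis
  proof (intro exI[of _ "card Z"] allI impI, elim conjE)
    fix I :: "'e list set" and n
    assume I: "finite I" "\<forall>p\<in>I. awalk j p j \<and> length p \<le> n"
    define f where "f p = (of_real (ratio (path_sim S p)) * first_col (path_orth S p), det (path_orth S p))" for p
    define V where "V = bounded_products Z n \<times> {1, -1::real}"
    have V: "finite V" "card V \<le> 2 * (n + 1) ^ card Z"
      using card_bounded_products[OF Z, of n] by (simp_all add: V_def card_cartesian_product)
    have "f \<in> I \<rightarrow> V"
    proof
      fix p assume "p \<in> I"
      then have p: "awalk j p j" "length p \<le> n" using I(2) by simp_all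
      have "of_real (ratio (path_sim S p)) * first_col (path_orth S p) \<in> bounded_products Z (length p)"
        unfolding Z_def ratio_path_sim
        by (rule path_code_in_bounded_products) (use p(1) orth_arc in \<open>simp_all add: awalk_def\<close>)
      then have "of_real (ratio (path_sim S p)) * first_col (path_orth S p) \<in> bounded_products Z n"
        using bounded_products_mono[OF p(2)] by blast
      then show "f p \<in> V" using det_orthogonal_matrix[OF orth_path[OF p(1)]] by (auto simp: f_def V_def)
    qed
    have "1 \<in> bounded_products Z n" using one_in_bounded_products bounded_products_mono[of 0 n] by blast
    then have "V \<noteq> {}" by (auto simp: V_def)
    obtain v where v: "card I \<le> card (f -` {v} \<inter> I) * card V"
      using pigeonhole_card[OF \<open>f \<in> I \<rightarrow> V\<close> I(1) V(1) \<open>V \<noteq> {}\<close>] by blast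
    define J where "J = f -` {v} \<inter> I"
    have eq: "ratio (path_sim S p) = ratio (path_sim S p') \<and> path_orth S p = path_orth S p'" 
      if pp: "p \<in> J" "p' \<in> J" for p p'
    proof -
      have w: "awalk j p j" "awalk j p' j" using pp I(2) by (simp_all add: J_def)
      have "f p = f p'" using pp by (simp add: J_def)
      then have c: "of_real (ratio (path_sim S p)) * first_col (path_orth S p) = of_real (ratio (path_sim S p')) * first_col (path_orth S p')"
        and d: "det (path_orth S p) = det (path_orth S p')" by (simp_all add: f_def)
      from c have "norm (of_real (ratio (path_sim S p)) * first_col (path_orth S p)) = norm (of_real (ratio (path_sim S p')) * first_col (path_orth S p'))"
        by (rule arg_cong)
      then have r: "ratio (path_sim S p) = ratio (path_sim S p')"
        using ratio_path_pos[OF w(1)] ratio_path_pos[OF w(2)] norm_first_col[OF orth_path[OF w(1)]] norm_first_col[OF orth_path[OF w(2)]]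
        by (simp add: norm_mult)
      then have "first_col (path_orth S p) = first_col (path_orth S p')" using c ratio_path_pos[OF w(2)] by simp
      with d have "path_orth S p = path_orth S p'"
        by (intro orthogonal_matrix_eqI orth_path[OF w(1)] orth_path[OF w(2)])
      with r show ?thesis by simp
    qed
    have "card I \<le> card J * card V" using v by (simp add: J_def)
    also have "\<dots> \<le> card J * (2 * (n + 1) ^ card Z)" using V(2) by (rule mult_le_mono2)
    finally have cJ: "card I \<le> card J * (2 * (n + 1) ^ card Z)" .
    have JI: "J \<subseteq> I" by (simp add: J_def)
    show "\<exists>J\<subseteq>I. \<exists>\<rho> T. (\<forall>p\<in>J. ratio (path_sim S p) = \<rho> \<and> path_orth S p = T) \<and> card I \<le> card J * (2 * (n + 1) ^ card Z)"
    proof (cases "J = {}")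
      case True
      then show ?thesis using cJ JI by (intro exI[of _ J] conjI) simp_all
    next
      case False
      then obtain p where p: "p \<in> J" by blast
      then have "\<forall>p'\<in>J. ratio (path_sim S p') = ratio (path_sim S p) \<and> path_orth S p' = path_orth S p"
        by (intro ballI eq)
      with cJ JI show ?thesis by blast
    qed
  qed
qed

lemma connectors:
  "\<exists>c \<kappa> l. 0 < \<kappa> \<and> (\<forall>k\<in>verts G. awalk k (c k) j \<and> \<kappa> \<le> ratio (path_sim S (c k)) \<and> length (c k) \<le> l)"
proof -
  have "\<forall>k\<in>verts G. \<exists>p. awalk k p j" using reach[OF _ j_in_verts] by simp
  from bchoice[OF this] obtain c where c: "\<forall>k\<in>verts G. awalk k (c k) j" ..
  define R where "R = insert 1 ((\<lambda>k. ratio (path_sim S (c k))) ` verts G)"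
  define M where "M = insert 0 ((\<lambda>k. length (c k)) ` verts G)"
  have fin: "finite R" "finite M" by (simp_all add: R_def M_def)
  have pos: "\<forall>x\<in>R. 0 < x" using c ratio_path_pos unfolding R_def by (intro ballI) (elim insertE imageE, simp, blast)
  then have "0 < Min R" using fin(1) by (subst Min_gr_iff) (simp_all add: R_def)
  moreover have "Min R \<le> ratio (path_sim S (c k))" if "k \<in> verts G" for k
    by (rule Min_le[OF fin(1)]) (use that in \<open>simp add: R_def\<close>)
  moreover have "length (c k) \<le> Max M" if "k \<in> verts G" for k
    by (rule Max_ge[OF fin(2)]) (use that in \<open>simp add: M_def\<close>)
  ultimately show ?thesis using c by (intro exI[of _ c] exI[of _ "Min R"] exI[of _ "Max M"]) simp
qed

definition separated_equal_cycles :: "'e list set \<Rightarrow> real \<Rightarrow> real^2^2 \<Rightarrow> bool" where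
  "separated_equal_cycles I \<rho> T \<longleftrightarrow> finite I \<and> I \<noteq> {} \<and> 0 < \<rho> \<and>
    (\<forall>p\<in>I. p \<noteq> [] \<and> awalk j p j \<and> ratio (path_sim S p) = \<rho> \<and> path_orth S p = T) \<and>
    disjoint_family_on (\<lambda>p. sim_map (path_sim S p) ` K j) I"

text \<open>
  The factor \<open>\<kappa>\<close> is a reserve for the loss of ratio when a further cycle is appended.
\<close>

lemma many_equal_cycles:
  assumes t: "0 \<le> t" "t < t'" and dim: "ereal t' < hausdorff_dim (K j)" and \<kappa>: "0 < \<kappa>"
  shows "\<exists>I \<rho> T. separated_equal_cycles I \<rho> T \<and> 1 \<le> real (card I) * (\<kappa> * \<rho>) powr t"
proof -
  have t': "0 < t'" using t by simp
  obtain \<delta> h where \<delta>: "0 < \<delta>" "0 < h" "ennreal h \<le> hausdorff_premeasure t' \<delta> (K j)"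
    using premeasure_pos_below_dim[OF less_imp_le[OF t'] dim] .
  obtain a b where ab: "0 < a" "a < 1" "0 < b" "b < 1" "\<forall>e\<in>arcs G. a \<le> ratio (S e) \<and> ratio (S e) \<le> b"
    using ratio_bounds by (elim exE conjE)
  obtain D where D: "D > 0" "\<forall>i\<in>verts G. \<forall>x\<in>K i. \<forall>y\<in>K i. dist x y \<le> D" using K_diam_bound by (elim exE conjE)
  obtain c \<kappa>' l where \<kappa>': "0 < \<kappa>'" and 
    c: "\<forall>k\<in>verts G. awalk k (c k) j \<and> \<kappa>' \<le> ratio (path_sim S (c k)) \<and> length (c k) \<le> l"
    using connectors by (elim exE conjE)
  obtain N where N: "\<forall>I n. finite I \<and> (\<forall>p\<in>I. awalk j p j \<and> length p \<le> n) \<longrightarrow>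
    (\<exists>J\<subseteq>I. \<exists>\<rho> T. (\<forall>p\<in>J. ratio (path_sim S p) = \<rho> \<and> path_orth S p = T) \<and> card I \<le> card J * (2 * (n + 1) ^ N))"
    using few_linear_parts by (elim exE)
  \<comment> \<open>the bound that the polynomial loss times \<open>b\<^bsup>n(t' - t)\<^esup>\<close> has to fall below\<close>
  define A where "A = h / (3 * D) powr t' * (\<kappa> * a * \<kappa>') powr t / 2"
  have A: "A > 0" using \<delta> D \<kappa> \<kappa>' ab by (simp add: A_def)
  have ev1: "\<forall>\<^sub>F n in sequentially. real ((n + (l + 1)) ^ N) * (b ^ n) powr (t' - t) \<le> A"
    using t A by (intro exponential_beats_polynomial ab) simp_all
  have "(\<lambda>n. 3 * D * b ^ n) \<longlonglongrightarrow> 3 * D * 0" using ab by (intro tendsto_intros LIMSEQ_power_zero) auto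
  then have ev2: "\<forall>\<^sub>F n in sequentially. 3 * D * b ^ n < \<delta>" using \<delta>(1) by (intro order_tendstoD) auto
  obtain n where n: "real ((n + (l + 1)) ^ N) * (b ^ n) powr (t' - t) \<le> A" "3 * D * b ^ n < \<delta>" "0 < n"
    using eventually_happens[OF eventually_conj[OF ev1 eventually_conj[OF ev2 eventually_gt_at_top[of 0]]]] by auto
  have bn: "0 < b ^ n" "b ^ n < 1" using ab n(3) by (simp_all add: power_less_one_iff)

  have pne: "piece p \<noteq> {}" if "p \<in> cut_set a b n" for p
    using K_nonempty[OF awalk_last_in_verts[OF cut_set_walk[OF that]]] by (simp add: piece_def)
  have "\<exists>I\<subseteq>cut_set a b n. disjoint_family_on piece I \<and>
      hausdorff_premeasure t' \<delta> (K j) \<le> ennreal (real (card I) * (3 * (D * b ^ n)) powr t')"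
  proof (rule packing_cover[OF cut_set_finite cut_set_cover[OF ab] pne _ _ _ t'])
    show "dist x y \<le> D * b ^ n" if "p \<in> cut_set a b n" "x \<in> piece p" "y \<in> piece p" for p x y
      by (rule piece_diam[OF D(2) that ab(3)])
  qed (use D(1) bn n(2) in simp_all)
  then obtain I0 where I0: "I0 \<subseteq> cut_set a b n" "disjoint_family_on piece I0"
      "hausdorff_premeasure t' \<delta> (K j) \<le> ennreal (real (card I0) * (3 * (D * b ^ n)) powr t')"
    by (elim exE conjE)
  have fI0: "finite I0" using I0(1) cut_set_finite by (rule finite_subset)
  have "ennreal h \<le> ennreal (real (card I0) * (3 * (D * b ^ n)) powr t')" using \<delta>(3) I0(3) by (rule order_trans)
  then have h: "h \<le> real (card I0) * (3 * (D * b ^ n)) powr t'" by (simp add: ennreal_le_iff)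

  \<comment> \<open>the path is closed up to a cycle; its image of \<open>K j\<close> stays inside the piece, so disjointness is kept\<close>
  define ext where "ext p = p @ c (awlast j p)" for p
  have ext_walk: "awalk j (ext p) j" and ext_ratio: "a * b ^ n * \<kappa>' \<le> ratio (path_sim S (ext p))"
    and ext_len: "length (ext p) \<le> n + l" and ext_ne: "ext p \<noteq> []"
    and ext_img: "sim_map (path_sim S (ext p)) ` K j \<subseteq> piece p" if p: "p \<in> I0" for p
  proof -
    have pc: "p \<in> cut_set a b n" using p I0(1) by (rule subsetD[rotated])
    then have w: "awalk j p (awlast j p)" and pr: "a * b ^ n \<le> ratio (path_sim S p)" "ratio (path_sim S p) \<le> b ^ n" "length p \<le> n"
      by (simp_all only: cut_set_def mem_Collect_eq)
    have ck: "awalk (awlast j p) (c (awlast j p)) j" "\<kappa>' \<le> ratio (path_sim S (c (awlast j p)))" "length (c (awlast j p)) \<le> l"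
      using bspec[OF c awalk_last_in_verts[OF w]] by simp_all
    show "awalk j (ext p) j" unfolding ext_def by (rule awalk_appendI[OF w ck(1)])
    show "a * b ^ n * \<kappa>' \<le> ratio (path_sim S (ext p))" unfolding ext_def ratio_path_sim_append
      using pr(1) ck(2) \<kappa>' ratio_path_pos[OF w] by (intro mult_mono) simp_all
    show "length (ext p) \<le> n + l" using pr(3) ck(3) by (simp add: ext_def)
    have "p \<noteq> []" using pr(2) bn(2) by auto
    then show "ext p \<noteq> []" by (simp add: ext_def)
    show "sim_map (path_sim S (ext p)) ` K j \<subseteq> piece p"
    proof
      fix x assume "x \<in> sim_map (path_sim S (ext p)) ` K j"
      then obtain y where y: "y \<in> K j" "x = sim_map (path_sim S p) (sim_map (path_sim S (c (awlast j p))) y)"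
        by (elim imageE) (simp add: ext_def sim_map_path_sim_append)
      have "sim_map (path_sim S (c (awlast j p))) y \<in> K (awlast j p)" using path_image[OF ck(1)] y(1) by blast
      then show "x \<in> piece p" unfolding piece_def y(2) by (rule imageI)
    qed
  qed
  have disj0: "p = p'" if pp: "p \<in> I0" "p' \<in> I0" 
      "sim_map (path_sim S (ext p)) ` K j \<inter> sim_map (path_sim S (ext p')) ` K j \<noteq> {}" for p p'
  proof (rule ccontr)
    assume "p \<noteq> p'"
    then have "piece p \<inter> piece p' = {}" using I0(2) pp(1,2) by (simp add: disjoint_family_on_def)
    then show False using pp(3) ext_img[OF pp(1)] ext_img[OF pp(2)] by blast
  qed
  have inj: "inj_on ext I0"
  proof (rule inj_onI)
    fix p p' assume pp: "p \<in> I0" "p' \<in> I0" "ext p = ext p'"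
    show "p = p'" by (rule disj0[OF pp(1,2)]) (use K_nonempty[OF j_in_verts] in \<open>simp add: pp(3)\<close>)
  qed
  define I1 where "I1 = ext ` I0"
  have I1: "finite I1" "card I1 = card I0" using fI0 inj by (simp_all add: I1_def card_image)
  have disj1: "disjoint_family_on (\<lambda>p. sim_map (path_sim S p) ` K j) I1"
    unfolding disjoint_family_on_def I1_def
  proof (intro ballI impI, elim imageE)
    fix q q' p p' assume "q \<noteq> q'" "q = ext p" "q' = ext p'" "p \<in> I0" "p' \<in> I0"
    then show "sim_map (path_sim S q) ` K j \<inter> sim_map (path_sim S q') ` K j = {}" using disj0[of p p'] by metis
  qed
  have "\<forall>p\<in>I1. awalk j p j \<and> length p \<le> n + l" unfolding I1_def using ext_walk ext_len by simp
  with I1(1) N obtain J \<rho> T where J: "J \<subseteq> I1" "\<forall>p\<in>J. ratio (path_sim S p) = \<rho> \<and> path_orth S p = T"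
      "card I1 \<le> card J * (2 * (n + l + 1) ^ N)" by meson
  have "card I0 > 0" using h \<delta>(2) by (cases "card I0 = 0") simp_all
  then have "card J > 0" using J(3) I1(2) by (cases "card J = 0") simp_all
  then have Jne: "J \<noteq> {}" by (cases "J = {}") simp_all
  have Jfin: "finite J" using J(1) I1(1) by (rule finite_subset)
  have Jw: "awalk j p j" "p \<noteq> []" "a * b ^ n * \<kappa>' \<le> \<rho>" if p: "p \<in> J" for p
  proof -
    obtain p0 where p0: "p0 \<in> I0" "p = ext p0" using p J(1) unfolding I1_def by blast
    show "awalk j p j" "p \<noteq> []" unfolding p0(2) using ext_walk[OF p0(1)] ext_ne[OF p0(1)] by simp_all
    show "a * b ^ n * \<kappa>' \<le> \<rho>" using bspec[OF J(2) p] ext_ratio[OF p0(1)] p0(2) by simp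
  qed
  obtain p1 where p1: "p1 \<in> J" using Jne by blast
  have \<rho>l: "a * b ^ n * \<kappa>' \<le> \<rho>" by (rule Jw(3)[OF p1])
  moreover have "0 < a * b ^ n * \<kappa>'" using ab bn \<kappa>' by simp
  ultimately have \<rho>: "0 < \<rho>" by simp
  have count: "1 \<le> real (card J) * (\<kappa> * \<rho>) powr t"
  proof -
    \<comment> \<open>cycles have length at most \<open>n + l\<close>, so \<open>2 * P\<close> bounds the number of linear parts, the factor \<open>2\<close> coming from the determinant\<close>
    define P where "P = real ((n + (l + 1)) ^ N)"
    define X where "X = b ^ n"
    have P: "P > 0" and X: "X > 0" using bn by (simp_all add: P_def X_def)
    have "real (card I0) \<le> real (card J * (2 * (n + l + 1) ^ N))" using J(3) I1(2) by (simp only: of_nat_le_iff)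
    also have "\<dots> = real (card J) * (2 * P)" by (simp add: P_def add.assoc)
    finally have cJ: "real (card I0) \<le> real (card J) * (2 * P)" .
    have "h \<le> real (card I0) * ((3 * D) powr t' * X powr t')"
      using h D(1) X by (simp add: X_def powr_mult[symmetric] mult.assoc)
    also have "\<dots> \<le> real (card J) * (2 * P) * ((3 * D) powr t' * X powr t')"
      using cJ by (intro mult_right_mono) simp_all
    finally have 1: "h / (3 * D) powr t' \<le> real (card J) * (2 * P) * X powr t'"
      using D(1) by (simp add: field_simps)
    have "P * X powr (t' - t) \<le> A" using n(1) by (simp add: P_def X_def)
    also have "\<dots> \<le> real (card J) * (2 * P) * X powr t' * (\<kappa> * a * \<kappa>') powr t / 2"
      unfolding A_def by (intro divide_right_mono mult_right_mono 1) simp_all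
    also have "X powr t' = X powr (t' - t) * X powr t" by (simp flip: powr_add)
    also have "real (card J) * (2 * P) * (X powr (t' - t) * X powr t) * (\<kappa> * a * \<kappa>') powr t / 2
       = P * X powr (t' - t) * (real (card J) * (X powr t * (\<kappa> * a * \<kappa>') powr t))" by (simp add: mult_ac)
    finally have "1 \<le> real (card J) * (X powr t * (\<kappa> * a * \<kappa>') powr t)" using P X by simp
    also have "X powr t * (\<kappa> * a * \<kappa>') powr t = (\<kappa> * (a * b ^ n * \<kappa>')) powr t"
      using X \<kappa> ab \<kappa>' by (simp add: X_def powr_mult[symmetric] mult_ac)
    also have "real (card J) * \<dots> \<le> real (card J) * (\<kappa> * \<rho>) powr t"
      using \<rho>l \<kappa> \<kappa>' ab bn t by (intro mult_left_mono powr_mono2) simp_all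
    finally show ?thesis .
  qed
  have "separated_equal_cycles J \<rho> T" unfolding separated_equal_cycles_def
  proof (intro conjI ballI)
    show "disjoint_family_on (\<lambda>p. sim_map (path_sim S p) ` K j) J"
      using disjoint_family_on_mono[OF J(1) disj1] .
    fix p assume p: "p \<in> J"
    show "ratio (path_sim S p) = \<rho>" "path_orth S p = T" using bspec[OF J(2) p] by simp_all
    show "p \<noteq> []" "awalk j p j" using Jw[OF p] by simp_all
  qed (fact Jfin Jne \<rho>)+
  with count show ?thesis by blast
qed

section \<open>Homogeneous systems inside the attractor\<close>

lemma generate_dense_generator_subset: "dense_generator Q \<Longrightarrow> generate O2 {Q} \<subseteq> gd_group G S j \<inter> SO2"
proof -
  interpret O2: group O2 by (rule group_O2)
  assume Q: "dense_generator Q"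
  have "subgroup (gd_group G S j) O2"
    unfolding gd_group_def by (rule O2.generate_is_subgroup) (use cycle_orths_orth in \<open>auto simp: O2_def\<close>)
  then have "subgroup (gd_group G S j \<inter> SO2) O2" using subgroup_SO2 by (rule O2.subgroups_Inter_pair)
  moreover have "{Q} \<subseteq> gd_group G S j \<inter> SO2" using Q by (simp add: dense_generator_def)
  ultimately show ?thesis by (rule O2.generate_subgroup_incl[rotated])
qed

text \<open>
  The smallest ratio of the finitely many correcting cycles serves as \<open>\<kappa>\<close>.  It is chosen before the
  cycles \<open>I\<close>, so that \<open>I\<close> may be taken large in terms of \<open>\<kappa>\<close>.
\<close>

lemma homogeneous_subsystem:
  "\<exists>\<kappa>>0. \<forall>I \<rho> T t. separated_equal_cycles I \<rho> T \<longrightarrow> 0 \<le> t \<longrightarrow>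
    1 \<le> real (card I) * (\<kappa> * \<rho>) powr t \<longrightarrow>
    (\<exists>r Q m F L. 0 < r \<and> r < 1 \<and> Q \<in> gd_group G S j \<inter> SO2 \<and>
      ss_ifs m F \<and> ss_attractor m F L \<and> strong_separation m F L \<and> L \<subseteq> K j \<and>
      ereal t \<le> hausdorff_dim L \<and>
      ss_group m F \<subseteq> gd_group G S j \<inter> SO2 \<and>
      gd_group G S j \<inter> SO2 \<subseteq> closure (ss_group m F) \<and>
      (\<forall>i\<in>{1..m}. orth (F i) = Q \<and> ratio (F i) = r))"
proof -
  obtain C where C: "finite C" "\<forall>c\<in>C. awalk j c j" "\<forall>T\<in>cycle_orths. \<exists>c\<in>C. dense_generator (T ** path_orth S c)"
    using dense_generator_extension by (elim exE conjE)
  define R where "R = insert 1 ((\<lambda>c. ratio (path_sim S c)) ` C)"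
  have fR: "finite R" using C(1) by (simp add: R_def)
  have pos: "\<forall>x\<in>R. 0 < x" unfolding R_def
  proof (intro ballI, elim insertE imageE)
    fix x c assume "x = ratio (path_sim S c)" "c \<in> C"
    then show "0 < x" using ratio_path_pos[OF bspec[OF C(2)], of c] by simp
  qed simp
  then have \<kappa>: "0 < Min R" using fR by (subst Min_gr_iff) (simp_all add: R_def)
  have \<kappa>le: "Min R \<le> ratio (path_sim S c)" if "c \<in> C" for c
    by (rule Min_le[OF fR]) (use that in \<open>simp add: R_def\<close>)
  show ?thesis
  proof (rule exI[of _ "Min R"], rule conjI[OF \<kappa>], intro allI impI)
    fix I \<rho> T t
    assume cycles: "separated_equal_cycles I \<rho> T" and t: "0 \<le> (t::real)"
      and count: "1 \<le> real (card I) * (Min R * \<rho>) powr t"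
    from cycles have I: "finite I" "I \<noteq> {}" "0 < \<rho>"
      and Ip: "\<forall>p\<in>I. p \<noteq> [] \<and> awalk j p j \<and> ratio (path_sim S p) = \<rho> \<and> path_orth S p = T"
      and disj: "disjoint_family_on (\<lambda>p. sim_map (path_sim S p) ` K j) I"
      unfolding separated_equal_cycles_def by - (elim conjE, assumption)+
    obtain p0 where p0: "p0 \<in> I" using I(2) by blast
    have "path_orth S p0 \<in> cycle_orths" by (rule cycle_orths_I) (use bspec[OF Ip p0] in simp_all)
    then have "T \<in> cycle_orths" using bspec[OF Ip p0] by simp
    then obtain c where c: "c \<in> C" "dense_generator (T ** path_orth S c)" using bspec[OF C(3)] by blast
    have cw: "awalk j c j" using bspec[OF C(2) c(1)] .
    define Q where "Q = T ** path_orth S c"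
    define r where "r = \<rho> * ratio (path_sim S c)"
    define m where "m = card I"
    obtain g where g: "bij_betw g {1..m} I" using ex_bij_betw_nat_finite_1[OF I(1)] unfolding m_def ..
    define F where "F i = path_sim S (g i @ c)" for i
    have m: "1 \<le> m" using I(1,2) by (simp add: m_def Suc_le_eq card_gt_0_iff)
    have gI: "g i \<in> I" if "i \<in> {1..m}" for i using g that by (rule bij_betwE[THEN bspec])
    have gw: "awalk j (g i) j" "g i \<noteq> []" "ratio (path_sim S (g i)) = \<rho>" "path_orth S (g i) = T" if "i \<in> {1..m}" for i
      using bspec[OF Ip gI[OF that]] by simp_all
    have Fw: "awalk j (g i @ c) j" if "i \<in> {1..m}" for i by (rule awalk_appendI[OF gw(1)[OF that] cw])
    have Fc: "contracting_similarity (F i)" if "i \<in> {1..m}" for i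
      unfolding F_def by (rule path_contracting[OF Fw[OF that]]) (use gw(2)[OF that] in simp)
    have Fr: "ratio (F i) = r" and Fo: "orth (F i) = Q" if "i \<in> {1..m}" for i
      using gw(3,4)[OF that] by (simp_all add: F_def r_def Q_def ratio_path_sim_append path_orth_append)
    have r: "0 < r" "r < 1" using Fc[of 1] Fr[of 1] m by (simp_all add: contracting_similarity_def)
    have dF: "dist (sim_map (F i) x) (sim_map (F i) y) = r * dist x y" if "i \<in> {1..m}" for i x y
      using dist_path[OF Fw[OF that], of x y] Fr[OF that] by (simp add: F_def)
    have sub: "sim_map (F i) ` K j \<subseteq> sim_map (path_sim S (g i)) ` K j" for i
    proof
      fix x assume "x \<in> sim_map (F i) ` K j"
      then obtain y where y: "y \<in> K j" "x = sim_map (path_sim S (g i)) (sim_map (path_sim S c) y)"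
        by (elim imageE) (simp add: F_def sim_map_path_sim_append)
      have "sim_map (path_sim S c) y \<in> K j" using path_image[OF cw] y(1) by blast
      then show "x \<in> sim_map (path_sim S (g i)) ` K j" unfolding y(2) by (rule imageI)
    qed
    have disjF: "disjoint_family_on (\<lambda>i. sim_map (F i) ` K j) {1..m}"
      unfolding disjoint_family_on_def
    proof (intro ballI impI)
      fix i k assume ik: "i \<in> {1..m}" "k \<in> {1..m}" "i \<noteq> k"
      have "inj_on g {1..m}" using g by (rule bij_betw_imp_inj_on)
      then have "g i \<noteq> g k" using ik by (simp add: inj_on_eq_iff)
      then have "sim_map (path_sim S (g i)) ` K j \<inter> sim_map (path_sim S (g k)) ` K j = {}"
        using disj gI[OF ik(1)] gI[OF ik(2)] by (simp add: disjoint_family_on_def)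
      then show "sim_map (F i) ` K j \<inter> sim_map (F k) ` K j = {}" using sub[of i] sub[of k] by blast
    qed
    have "\<exists>L\<subseteq>K j. L \<noteq> {} \<and> compact L \<and> L = (\<Union>i\<in>{1..m}. sim_map (F i) ` L)"
    proof (rule attractor_in_compact[OF _ K_compact[OF j_in_verts] K_nonempty[OF j_in_verts] _ _ _ _ disjF])
      show "{1..m} \<noteq> {}" using m by simp
      fix i assume i: "i \<in> {1..m}"
      have "r-lipschitz_on UNIV (sim_map (F i))" using dF[OF i] r by (simp add: lipschitz_on_def)
      then show "continuous_on UNIV (sim_map (F i))" by (rule lipschitz_on_continuous_on)
      show "inj (sim_map (F i))"
      proof (rule injI)
        fix x y assume "sim_map (F i) x = sim_map (F i) y"
        then have "r * dist x y = 0" using dF[OF i, of x y] by simp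
        then show "x = y" using r by simp
      qed
      show "sim_map (F i) ` K j \<subseteq> K j" using sub[of i] path_image[OF gw(1)[OF i]] by (rule subset_trans)
    qed simp
    then obtain L where L: "L \<subseteq> K j" "L \<noteq> {}" "compact L" "L = (\<Union>i\<in>{1..m}. sim_map (F i) ` L)"
      by (elim exE conjE)
    have disjL: "disjoint_family_on (\<lambda>i. sim_map (F i) ` L) {1..m}"
      unfolding disjoint_family_on_def
    proof (intro ballI impI)
      fix i k assume ik: "i \<in> {1..m}" "k \<in> {1..m}" "i \<noteq> k"
      then have "sim_map (F i) ` K j \<inter> sim_map (F k) ` K j = {}" using disjF by (simp add: disjoint_family_on_def)
      then show "sim_map (F i) ` L \<inter> sim_map (F k) ` L = {}"
        using image_mono[OF L(1), of "sim_map (F i)"] image_mono[OF L(1), of "sim_map (F k)"] by blast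
    qed
    have "Min R * \<rho> \<le> r" using \<kappa>le[OF c(1)] I(3) by (simp add: r_def mult.commute)
    then have "(Min R * \<rho>) powr t \<le> r powr t" using \<kappa> I(3) t by (intro powr_mono2) simp_all
    then have "real (card I) * (Min R * \<rho>) powr t \<le> real (card I) * r powr t" by (intro mult_left_mono) simp_all
    with count have mr: "1 \<le> real (card {1..m}) * r powr t" by (simp add: m_def)
    have dimL: "ereal t \<le> hausdorff_dim L"
    proof (rule dim_homogeneous_ge[OF _ L(3,2) r _ dF disjL mr])
      show "sim_map (F i) ` L \<subseteq> L" if "i \<in> {1..m}" for i
        using UN_upper[OF that, of "\<lambda>i. sim_map (F i) ` L"] L(4) by argo
    qed simp_all
    have "(\<lambda>i. orth (F i)) ` {1..m} = {Q}"
    proof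
      show "(\<lambda>i. orth (F i)) ` {1..m} \<subseteq> {Q}" using Fo by auto
      have "Q = orth (F 1)" "1 \<in> {1..m}" using Fo[of 1] m by simp_all
      then show "{Q} \<subseteq> (\<lambda>i. orth (F i)) ` {1..m}" by blast
    qed
    then have grp: "ss_group m F = generate O2 {Q}" by (simp add: ss_group_def)
    have gQ: "dense_generator Q" using c(2) by (simp add: Q_def)
    show "\<exists>r Q m F L. 0 < r \<and> r < 1 \<and> Q \<in> gd_group G S j \<inter> SO2 \<and>
      ss_ifs m F \<and> ss_attractor m F L \<and> strong_separation m F L \<and> L \<subseteq> K j \<and>
      ereal t \<le> hausdorff_dim L \<and>
      ss_group m F \<subseteq> gd_group G S j \<inter> SO2 \<and>
      gd_group G S j \<inter> SO2 \<subseteq> closure (ss_group m F) \<and>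
      (\<forall>i\<in>{1..m}. orth (F i) = Q \<and> ratio (F i) = r)"
    proof (intro exI[of _ r] exI[of _ Q] exI[of _ m] exI[of _ F] exI[of _ L] conjI ballI)
      show "Q \<in> gd_group G S j \<inter> SO2" using gQ unfolding dense_generator_def by (rule conjunct1)
      show "ss_ifs m F" using m Fc by (simp add: ss_ifs_def)
      show "ss_attractor m F L" unfolding ss_attractor_def by (intro conjI L(2,3,4))
      show "strong_separation m F L" unfolding strong_separation_def by (rule disjL)
      show "ss_group m F \<subseteq> gd_group G S j \<inter> SO2" unfolding grp by (rule generate_dense_generator_subset[OF gQ])
      show "gd_group G S j \<inter> SO2 \<subseteq> closure (ss_group m F)"
        using gQ unfolding grp dense_generator_def by (rule conjunct2)
    qed (fact r L(1) dimL | erule Fo | erule Fr)+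
  qed
qed

end

theorem theorem1p5:
  fixes G :: "(nat, 'e) pre_digraph" and q :: nat and S :: "'e \<Rightarrow> similarity"
    and K :: "nat \<Rightarrow> (real^2) set" and j :: nat and \<epsilon> :: real
  assumes "gd_ifs G q S"
    and "strongly_connected G"
    and "gd_attractor G S K"
    and "\<exists>i\<in>{1..q}. \<exists>x\<in>K i. \<exists>y\<in>K i. x \<noteq> y"
    and "j \<in> {1..q}"
    and "\<epsilon> > 0"
  shows "\<exists>r Q m F L.
    0 < r \<and> r < 1 \<and> Q \<in> gd_group G S j \<inter> SO2 \<and>
    ss_ifs m F \<and> ss_attractor m F L \<and> strong_separation m F L \<and>
    L \<subseteq> K j \<and>
    hausdorff_dim (K j) - ereal \<epsilon> < hausdorff_dim L \<and>
    ss_group m F \<subseteq> gd_group G S j \<inter> SO2 \<and>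
    gd_group G S j \<inter> SO2 \<subseteq> closure (ss_group m F) \<and>
    (\<forall>i\<in>{1..m}. orth (F i) = Q \<and> ratio (F i) = r)"
proof -
  interpret gd_system G q S K j using assms by unfold_locales
  obtain d where d: "hausdorff_dim (K j) = ereal d" "0 \<le> d"
  proof -
    obtain D where "hausdorff_dim (K j) \<le> ereal D" using dim_K_finite by (elim exE)
    then show ?thesis using hausdorff_dim_nonneg[of "K j"] that by (cases "hausdorff_dim (K j)") auto
  qed
  obtain \<kappa> where \<kappa>: "0 < \<kappa>" and sys: "\<forall>I \<rho> T t. separated_equal_cycles I \<rho> T \<longrightarrow> 0 \<le> t \<longrightarrow>
    1 \<le> real (card I) * (\<kappa> * \<rho>) powr t \<longrightarrow>
    (\<exists>r Q m F L. 0 < r \<and> r < 1 \<and> Q \<in> gd_group G S j \<inter> SO2 \<and>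
      ss_ifs m F \<and> ss_attractor m F L \<and> strong_separation m F L \<and> L \<subseteq> K j \<and>
      ereal t \<le> hausdorff_dim L \<and>
      ss_group m F \<subseteq> gd_group G S j \<inter> SO2 \<and>
      gd_group G S j \<inter> SO2 \<subseteq> closure (ss_group m F) \<and>
      (\<forall>i\<in>{1..m}. orth (F i) = Q \<and> ratio (F i) = r))"
    using homogeneous_subsystem by (elim exE conjE)
  \<comment> \<open>strictly below \<open>d\<close> unless \<open>d = 0\<close>, where a single cycle and \<open>t = 0\<close> suffice\<close>
  define t where "t = max 0 (d - \<epsilon> / 2)"
  have t: "0 \<le> t" "d - \<epsilon> < t" using d(2) assms(6) by (auto simp: t_def)
  have "\<exists>I \<rho> T. separated_equal_cycles I \<rho> T \<and> 1 \<le> real (card I) * (\<kappa> * \<rho>) powr t"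
  proof (cases "d = 0")
    case True
    then have t0: "t = 0" using assms(6) by (simp add: t_def)
    obtain p where p: "p \<noteq> []" "awalk j p j" using cycle_exists by (elim exE conjE)
    show ?thesis
      using p ratio_path_pos[OF p(2)] \<kappa> unfolding t0
      by (intro exI[of _ "{p}"] exI[of _ "ratio (path_sim S p)"] exI[of _ "path_orth S p"] conjI)
        (simp_all add: separated_equal_cycles_def disjoint_family_on_def)
  next
    case False
    then have "t < d" using d(2) assms(6) by (simp add: t_def)
    then have "t < (t + d) / 2" "ereal ((t + d) / 2) < hausdorff_dim (K j)" by (simp_all add: d(1))
    with t(1) show ?thesis using \<kappa> by (rule many_equal_cycles)
  qed
  then obtain I \<rho> T where I: "separated_equal_cycles I \<rho> T" "1 \<le> real (card I) * (\<kappa> * \<rho>) powr t"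
    by (elim exE conjE)
  obtain r Q m F L where *: "0 < r" "r < 1" "Q \<in> gd_group G S j \<inter> SO2"
      "ss_ifs m F" "ss_attractor m F L" "strong_separation m F L" "L \<subseteq> K j"
      "ereal t \<le> hausdorff_dim L" "ss_group m F \<subseteq> gd_group G S j \<inter> SO2"
      "gd_group G S j \<inter> SO2 \<subseteq> closure (ss_group m F)"
      "\<forall>i\<in>{1..m}. orth (F i) = Q \<and> ratio (F i) = r"
    using sys[rule_format, OF I(1) t(1) I(2)] by (elim exE conjE)
  have "hausdorff_dim (K j) - ereal \<epsilon> < ereal t" using t(2) by (simp add: d(1))
  then have "hausdorff_dim (K j) - ereal \<epsilon> < hausdorff_dim L" using *(8) by (rule less_le_trans)
  then show ?thesis
    by (intro exI[of _ r] exI[of _ Q] exI[of _ m] exI[of _ F] exI[of _ L] conjI *(1-7,9-11))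
qed

end
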